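(* Let $P:=(\iota\Rightarrow\iota)\Rightarrow\iota$. For every closed System T term $t$ of type $P$ and every sequence $\alpha:\mathbb{N}\to\mathbb{N}$, we have $[\![t]\!]\,\alpha=[\![\mathsf{dial}^T\,(\mathsf{dialogueTree}_{P}(t))]\!]\,\alpha$.
   Context: Metatheory: constructive Martin-Löf type theory without function extensionality; "$=$" is the identity type; $\mathsf{Natrec}\,f\,x\,0=x$, $\mathsf{Natrec}\,f\,x\,(n+1)=f\,n\,(\mathsf{Natrec}\,f\,x\,n)$. System T: types generated by base type $\iota$ and $\sigma\Rightarrow\tau$; terms in a context of distinct typed variables: variables, $\mathsf{zero}:\iota$, $\mathsf{succ}\,t:\iota$ ($t:\iota$), $\mathsf{rec}_\sigma\,t\,p\,q:\sigma$ ($t:\iota\Rightarrow\sigma\Rightarrow\sigma$, $p:\sigma$, $q:\iota$), $\lambda$-abstraction and application. Closed = empty context. Set interpretation: $[\![\iota]\!]=\mathbb{N}$, $[\![\sigma\Rightarrow\tau]\!]=[\![\sigma]\!]\to[\![\tau]\!]$, with $[\![x]\!]\gamma=\gamma(x)$, $[\![\mathsf{zero}]\!]=0$, $[\![\mathsf{succ}\,t]\!]\gamma=[\![t]\!]\gamma+1$, $[\![\mathsf{rec}_\sigma t_1t_2t_3]\!]\gamma=\mathsf{Natrec}([\![t_1]\!]\gamma)([\![t_2]\!]\gamma)([\![t_3]\!]\gamma)$, and standard clauses for $\lambda$ and application; $[\![t]\!]$ for closed $t$. Internal Church-encoded dialogue trees: for System T types $A,\sigma$, let $\mathsf{ChD}_A(\sigma):=(\sigma\Rightarrow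 A)\Rightarrow((\iota\Rightarrow A)\Rightarrow\iota\Rightarrow A)\Rightarrow A$. Closed terms: $\eta_A:=\lambda z\,e\,b.\,e\,z$; $\beta_A:=\lambda\varphi\,x\,e\,b.\,b\,(\lambda y.\varphi\,y\,e\,b)\,x$; $K_A:=\lambda f\,d\,e'\,b'.\,d\,(\lambda x.f\,x\,e'\,b')\,b'$ of type $(\iota\Rightarrow\mathsf{ChD}_A(\iota))\Rightarrow\mathsf{ChD}_A(\iota)\Rightarrow\mathsf{ChD}_A(\iota)$; $\mathsf{map}_A:=\lambda f.K_A(\lambda x.\eta_A(f\,x))$. Type translation: $\lceil\iota\rceil_A=\mathsf{ChD}_A(\iota)$, $\lceil\sigma\Rightarrow\tau\rceil_A=\lceil\sigma\rceil_A\Rightarrow\lceil\tau\rceil_A$, contexts pointwise. Generalised internal Kleisli extension (closed terms of type $(\iota\Rightarrow\lceil\sigma\rceil_A)\Rightarrow\mathsf{ChD}_A(\iota)\Rightarrow\lceil\sigma\rceil_A$): $\mathsf{ext}^T_{\iota,A}:=K_A$, $\mathsf{ext}^T_{\sigma_1\Rightarrow\sigma_2,A}:=\lambda f\,d\,s.\,\mathsf{ext}^T_{\sigma_2,A}(\lambda x.f\,x\,s)\,d$. Term translation: $\lceil x\rceil_A=x$, $\lceil\mathsf{zero}\rceil_A=\eta_A\,\mathsf{zero}$, $\lceil\mathsf{succ}\,t\rceil_A=\mathsf{map}_A\,(\lambda n.\mathsf{succ}\,n)\,\lceil t\rceil_A$, $\lceil\mathsf{rec}_\sigma\,t_1\,t_2\,t_3\rceil_A=\mathsf{ext}^T_{\sigma,A}\,(\lambda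 n.\mathsf{rec}_{\lceil\sigma\rceil_A}(\lambda x.\lceil t_1\rceil_A(\eta_A\,x))\,\lceil t_2\rceil_A\,n)\,\lceil t_3\rceil_A$, $\lceil\lambda x.t\rceil_A=\lambda x.\lceil t\rceil_A$, $\lceil t\,p\rceil_A=\lceil t\rceil_A\lceil p\rceil_A$. Internal generic sequence: $\mathsf{generic}_A:=K_A(\lambda i.\beta_A\,\eta_A\,i)$. For closed $t:(\iota\Rightarrow\iota)\Rightarrow\iota$, $\mathsf{dialogueTree}_A(t):=\lceil t\rceil_A\,\mathsf{generic}_A$, a closed term of type $\mathsf{ChD}_A(\iota)$. Internal dialogue operator: $\mathsf{dial}^T:=\lambda d.\,d\,(\lambda z\,w.\,z)\,(\lambda\varphi\,x\,\alpha.\,\varphi\,(\alpha\,x)\,\alpha)$, a closed term of type $\mathsf{ChD}_{P}(\iota)\Rightarrow P$ where $P=(\iota\Rightarrow\iota)\Rightarrow\iota$. *)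

theory Defs
  imports Main "HOL-Library.FuncSet"
begin

subsection \<open>System T\<close>

datatype ty = Iota | Arr ty ty (infixr "\<rightarrowtail>" 60)

text \<open>Terms are raw terms with de Bruijn indices; a context is the list of the types of the
  variables, the innermost first.\<close>

datatype tm =
    Var nat
  | Zero
  | Succ tm
  | Rec ty tm tm tm
  | Lam ty tm
  | App tm tm (infixl "\<cdot>" 100)

inductive has_type :: "ty list \<Rightarrow> tm \<Rightarrow> ty \<Rightarrow> bool" where
  Var: "i < length \<Gamma> \<Longrightarrow> has_type \<Gamma> (Var i) (\<Gamma> ! i)"
| Zero: "has_type \<Gamma> Zero Iota"
| Succ: "has_type \<Gamma> t Iota \<Longrightarrow> has_type \<Gamma> (Succ t) Iota"
| Rec: "has_type \<Gamma> t (Iota \<rightarrowtail> \<sigma> \<rightarrowtail> \<sigma>) \<Longrightarrow> has_type \<Gamma> p \<sigma> \<Longrightarrow> has_type \<Gamma> q Iota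
    \<Longrightarrow> has_type \<Gamma> (Rec \<sigma> t p q) \<sigma>"
| Lam: "has_type (\<sigma> # \<Gamma>) t \<tau> \<Longrightarrow> has_type \<Gamma> (Lam \<sigma> t) (\<sigma> \<rightarrowtail> \<tau>)"
| App: "has_type \<Gamma> t (\<sigma> \<rightarrowtail> \<tau>) \<Longrightarrow> has_type \<Gamma> p \<sigma> \<Longrightarrow> has_type \<Gamma> (t \<cdot> p) \<tau>"

text \<open>The value of \<open>type_of\<close> is meaningful on well-typed terms only.\<close>

fun cod :: "ty \<Rightarrow> ty" where
  "cod (\<sigma> \<rightarrowtail> \<tau>) = \<tau>"
| "cod Iota = Iota"

fun type_of :: "ty list \<Rightarrow> tm \<Rightarrow> ty" where
  "type_of \<Gamma> (Var i) = \<Gamma> ! i"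
| "type_of \<Gamma> Zero = Iota"
| "type_of \<Gamma> (Succ t) = Iota"
| "type_of \<Gamma> (Rec \<sigma> t p q) = \<sigma>"
| "type_of \<Gamma> (Lam \<sigma> t) = \<sigma> \<rightarrowtail> type_of (\<sigma> # \<Gamma>) t"
| "type_of \<Gamma> (t \<cdot> p) = cod (type_of \<Gamma> t)"

lemma type_of_eq: "has_type \<Gamma> t \<sigma> \<Longrightarrow> type_of \<Gamma> t = \<sigma>"
  by (induction rule: has_type.induct) auto

fun types_in :: "ty list \<Rightarrow> tm \<Rightarrow> ty set" where
  "types_in \<Gamma> (Var i) = {type_of \<Gamma> (Var i)}"
| "types_in \<Gamma> Zero = {type_of \<Gamma> Zero}"
| "types_in \<Gamma> (Succ t) = {type_of \<Gamma> (Succ t)} \<union> types_in \<Gamma> t"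
| "types_in \<Gamma> (Rec \<sigma> t p q) =
    {type_of \<Gamma> (Rec \<sigma> t p q)} \<union> types_in \<Gamma> t \<union> types_in \<Gamma> p \<union> types_in \<Gamma> q"
| "types_in \<Gamma> (Lam \<sigma> t) = {type_of \<Gamma> (Lam \<sigma> t)} \<union> types_in (\<sigma> # \<Gamma>) t"
| "types_in \<Gamma> (t \<cdot> p) = {type_of \<Gamma> (t \<cdot> p)} \<union> types_in \<Gamma> t \<union> types_in \<Gamma> p"

lemma finite_types_in: "finite (types_in \<Gamma> t)"
  by (induction \<Gamma> t rule: types_in.induct) auto

text \<open>\<open>lift d k t\<close> inserts \<open>d\<close> new variables into the context of \<open>t\<close> at position \<open>k\<close>.\<close>

primrec lift :: "nat \<Rightarrow> nat \<Rightarrow> tm \<Rightarrow> tm" where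
  "lift d k (Var i) = Var (if i < k then i else i + d)"
| "lift d k Zero = Zero"
| "lift d k (Succ t) = Succ (lift d k t)"
| "lift d k (Rec \<sigma> t p q) = Rec \<sigma> (lift d k t) (lift d k p) (lift d k q)"
| "lift d k (Lam \<sigma> t) = Lam \<sigma> (lift d (Suc k) t)"
| "lift d k (t \<cdot> p) = lift d k t \<cdot> lift d k p"


subsection \<open>Set interpretation\<close>

text \<open>
  The sets \<open>\<lbrakk>\<sigma>\<rbrakk>\<close>, with \<open>\<lbrakk>\<iota>\<rbrakk>\<close> the natural numbers and \<open>\<lbrakk>\<sigma> \<rightarrowtail> \<tau>\<rbrakk>\<close> the set of all functions
  from \<open>\<lbrakk>\<sigma>\<rbrakk>\<close> to \<open>\<lbrakk>\<tau>\<rbrakk>\<close>, cannot all be subsets of one HOL type: already the hierarchy over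
  \<open>\<iota>\<close>, \<open>\<iota> \<rightarrowtail> \<iota>\<close>, \<open>(\<iota> \<rightarrowtail> \<iota>) \<rightarrowtail> \<iota>\<close>, \ldots outgrows every type whose existence HOL proves. A term,
  however, involves only finitely many types. So the interpretation takes place in an
  arbitrary type \<open>'v\<close> in which the sets \<open>\<lbrakk>\<sigma>\<rbrakk>\<close> are represented, up to bijection, by carriers
  \<open>El M \<sigma>\<close>, and \<open>standard M \<sigma>\<close> says that \<open>\<sigma>\<close> and all the types it is built from
  are interpreted as they should be. The carriers of different types need not be disjoint.
\<close>

record 'v interp =
  El :: "ty \<Rightarrow> 'v set"
  Num :: "nat \<Rightarrow> 'v"
  Ap :: "ty \<Rightarrow> ty \<Rightarrow> 'v \<Rightarrow> 'v \<Rightarrow> 'v"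

primrec standard :: "'v interp \<Rightarrow> ty \<Rightarrow> bool" where
  "standard M Iota \<longleftrightarrow> bij_betw (Num M) UNIV (El M Iota)"
| "standard M (\<sigma> \<rightarrowtail> \<tau>) \<longleftrightarrow> standard M \<sigma> \<and> standard M \<tau> \<and>
    bij_betw (\<lambda>v. restrict (Ap M \<sigma> \<tau> v) (El M \<sigma>)) (El M (\<sigma> \<rightarrowtail> \<tau>)) (El M \<sigma> \<rightarrow>\<^sub>E El M \<tau>)"

definition Abs :: "'v interp \<Rightarrow> ty \<Rightarrow> ty \<Rightarrow> ('v \<Rightarrow> 'v) \<Rightarrow> 'v" where
  "Abs M \<sigma> \<tau> f = (THE v. v \<in> El M (\<sigma> \<rightarrowtail> \<tau>) \<and> (\<forall>x \<in> El M \<sigma>. Ap M \<sigma> \<tau> v x = f x))"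

definition nat_of :: "'v interp \<Rightarrow> 'v \<Rightarrow> nat" where
  "nat_of M v = (THE n. Num M n = v)"

text \<open>The representative in \<open>\<lbrakk>\<iota> \<rightarrowtail> \<iota>\<rbrakk>\<close> of a sequence of natural numbers.\<close>

definition seq :: "'v interp \<Rightarrow> (nat \<Rightarrow> nat) \<Rightarrow> 'v" where
  "seq M \<alpha> = Abs M Iota Iota (\<lambda>v. Num M (\<alpha> (nat_of M v)))"

fun sem :: "'v interp \<Rightarrow> ty list \<Rightarrow> tm \<Rightarrow> 'v list \<Rightarrow> 'v" where
  "sem M \<Gamma> (Var i) \<gamma> = \<gamma> ! i"
| "sem M \<Gamma> Zero \<gamma> = Num M 0"
| "sem M \<Gamma> (Succ t) \<gamma> = Num M (nat_of M (sem M \<Gamma> t \<gamma>) + 1)"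
| "sem M \<Gamma> (Rec \<sigma> t p q) \<gamma> =
    rec_nat (sem M \<Gamma> p \<gamma>)
      (\<lambda>n x. Ap M \<sigma> \<sigma> (Ap M Iota (\<sigma> \<rightarrowtail> \<sigma>) (sem M \<Gamma> t \<gamma>) (Num M n)) x)
      (nat_of M (sem M \<Gamma> q \<gamma>))"
| "sem M \<Gamma> (Lam \<sigma> t) \<gamma> = Abs M \<sigma> (type_of (\<sigma> # \<Gamma>) t) (\<lambda>x. sem M (\<sigma> # \<Gamma>) t (x # \<gamma>))"
| "sem M \<Gamma> (t \<cdot> p) \<gamma> =
    Ap M (type_of \<Gamma> p) (type_of \<Gamma> (t \<cdot> p)) (sem M \<Gamma> t \<gamma>) (sem M \<Gamma> p \<gamma>)"

text \<open>Every finite set of types is standard in some HOL type: iterate \<open>standard_step\<close>,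
  starting from \<open>standard_base\<close>.\<close>

primrec height :: "ty \<Rightarrow> nat" where
  "height Iota = 0"
| "height (\<sigma> \<rightarrowtail> \<tau>) = Suc (max (height \<sigma>) (height \<tau>))"

lemma standard_base: "\<exists>M :: nat interp. \<forall>\<sigma>. height \<sigma> \<le> 0 \<longrightarrow> standard M \<sigma>"
proof (intro exI allI impI)
  fix \<sigma> assume "height \<sigma> \<le> 0"
  then show "standard \<lparr>El = \<lambda>_. UNIV, Num = \<lambda>n. n, Ap = \<lambda>_ _ v _. v\<rparr> \<sigma>"
    by (cases \<sigma>) (auto simp: bij_betw_def)
qed

lemma standard_step:
  assumes M: "\<forall>\<sigma>. height \<sigma> \<le> n \<longrightarrow> standard (M :: 'v interp) \<sigma>"
  shows "\<exists>M' :: ('v \<Rightarrow> 'v) interp. \<forall>\<sigma>. height \<sigma> \<le> Suc n \<longrightarrow> standard M' \<sigma>"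
proof -
  let ?c = "\<lambda>(v::'v) (_::'v). v"
  define M' :: "('v \<Rightarrow> 'v) interp" where
    "M' = \<lparr>El = \<lambda>\<sigma>. if height \<sigma> \<le> n then ?c ` El M \<sigma>
              else (case \<sigma> of Iota \<Rightarrow> {} | Arr a b \<Rightarrow> El M a \<rightarrow>\<^sub>E El M b),
           Num = \<lambda>k. ?c (Num M k),
           Ap = \<lambda>a b f x. if height (a \<rightarrowtail> b) \<le> n then ?c (Ap M a b (f undefined) (x undefined))
              else ?c (f (x undefined))\<rparr>"
  have El: "El M' \<sigma> = ?c ` El M \<sigma>" if "height \<sigma> \<le> n" for \<sigma>
    using that by (simp add: M'_def)
  have iota: "standard M' Iota"
  proof -
    have "bij_betw (Num M) UNIV (El M Iota)" using M by (metis height.simps(1) le0 standard.simps(1))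
    moreover have "bij_betw ?c (El M Iota) (?c ` El M Iota)"
      by (auto simp: bij_betw_def inj_on_def fun_eq_iff)
    ultimately have "bij_betw (?c \<circ> Num M) UNIV (?c ` El M Iota)"
      by (rule bij_betw_trans)
    then show ?thesis by (simp add: M'_def comp_def)
  qed
  have arr: "bij_betw (\<lambda>v. restrict (Ap M' a b v) (El M' a)) (El M' (a \<rightarrowtail> b)) (El M' a \<rightarrow>\<^sub>E El M' b)"
    if h: "height (a \<rightarrowtail> b) \<le> Suc n" for a b
  proof -
    define g where "g h = (\<lambda>x \<in> ?c ` El M a. ?c (h (x undefined)))" for h :: "'v \<Rightarrow> 'v"
    have ha: "El M' a = ?c ` El M a" and hb: "El M' b = ?c ` El M b"
      using h by (auto intro!: El)
    have g: "bij_betw g (El M a \<rightarrow>\<^sub>E El M b) (El M' a \<rightarrow>\<^sub>E El M' b)"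
    proof (rule bij_betwI[where g = "\<lambda>k. \<lambda>x \<in> El M a. k (?c x) undefined"])
      show "g \<in> (El M a \<rightarrow>\<^sub>E El M b) \<rightarrow> (El M' a \<rightarrow>\<^sub>E El M' b)"
        by (auto simp: g_def ha hb PiE_iff)
      show "(\<lambda>k. \<lambda>x \<in> El M a. k (?c x) undefined) \<in> (El M' a \<rightarrow>\<^sub>E El M' b) \<rightarrow> (El M a \<rightarrow>\<^sub>E El M b)"
        by (fastforce simp: ha hb PiE_iff)
      show "(\<lambda>x \<in> El M a. g h (?c x) undefined) = h" if "h \<in> El M a \<rightarrow>\<^sub>E El M b" for h
        using that by (auto simp: g_def fun_eq_iff PiE_iff extensional_def)
      show "g (\<lambda>x \<in> El M a. k (?c x) undefined) = k" if k: "k \<in> El M' a \<rightarrow>\<^sub>E El M' b" for k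
      proof
        fix x
        show "g (\<lambda>x \<in> El M a. k (?c x) undefined) x = k x"
        proof (cases "x \<in> ?c ` El M a")
          case True
          then obtain y where y: "x = ?c y" "y \<in> El M a" by auto
          then have "k x \<in> ?c ` El M b" using k by (auto simp: ha hb PiE_iff)
          then show ?thesis using y by (auto simp: g_def)
        next
          case False
          then show ?thesis using k by (auto simp: g_def ha PiE_iff extensional_def)
        qed
      qed
    qed
    show ?thesis
    proof (cases "height (a \<rightarrowtail> b) \<le> n")
      case True
      then have "standard M (a \<rightarrowtail> b)" using M by blast
      then have "bij_betw (\<lambda>v. restrict (Ap M a b v) (El M a)) (El M (a \<rightarrowtail> b)) (El M a \<rightarrow>\<^sub>E El M b)"
        by simp
      moreover have "bij_betw (\<lambda>v. v undefined) (?c ` El M (a \<rightarrowtail> b)) (El M (a \<rightarrowtail> b))"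
        by (rule bij_betwI[where g = ?c]) auto
      ultimately have "bij_betw (g \<circ> ((\<lambda>v. restrict (Ap M a b v) (El M a)) \<circ> (\<lambda>v. v undefined)))
          (El M' (a \<rightarrowtail> b)) (El M' a \<rightarrow>\<^sub>E El M' b)"
        unfolding El[OF True] using g by (blast intro: bij_betw_trans)
      moreover have "g \<circ> ((\<lambda>v. restrict (Ap M a b v) (El M a)) \<circ> (\<lambda>v. v undefined))
          = (\<lambda>v. restrict (Ap M' a b v) (El M' a))"
        using True by (auto simp: fun_eq_iff g_def ha M'_def)
      ultimately show ?thesis by simp
    next
      case False
      then have "El M' (a \<rightarrowtail> b) = (El M a \<rightarrow>\<^sub>E El M b)"
        by (simp add: M'_def)
      moreover have "g = (\<lambda>v. restrict (Ap M' a b v) (El M' a))"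
        using False by (simp add: fun_eq_iff g_def ha) (simp add: M'_def)
      ultimately show ?thesis using g by simp
    qed
  qed
  have "height \<sigma> \<le> Suc n \<longrightarrow> standard M' \<sigma>" for \<sigma>
    by (induction \<sigma>) (use iota arr in auto)
  then show ?thesis by blast
qed


subsection \<open>Internal dialogue trees\<close>

definition ChD :: "ty \<Rightarrow> ty \<Rightarrow> ty" where
  "ChD A \<sigma> = (\<sigma> \<rightarrowtail> A) \<rightarrowtail> ((Iota \<rightarrowtail> A) \<rightarrowtail> Iota \<rightarrowtail> A) \<rightarrowtail> A"

text \<open>\<open>\<lambda>z e b. e z\<close>\<close>
definition eta :: "ty \<Rightarrow> tm" where
  "eta A = Lam Iota (Lam (Iota \<rightarrowtail> A) (Lam ((Iota \<rightarrowtail> A) \<rightarrowtail> Iota \<rightarrowtail> A) (Var 1 \<cdot> Var 2)))"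

text \<open>\<open>\<lambda>\<phi> x e b. b (\<lambda>y. \<phi> y e b) x\<close>\<close>
definition beta :: "ty \<Rightarrow> tm" where
  "beta A = Lam (Iota \<rightarrowtail> ChD A Iota) (Lam Iota
    (Lam (Iota \<rightarrowtail> A) (Lam ((Iota \<rightarrowtail> A) \<rightarrowtail> Iota \<rightarrowtail> A)
      (Var 0 \<cdot> Lam Iota (Var 4 \<cdot> Var 0 \<cdot> Var 2 \<cdot> Var 1) \<cdot> Var 2))))"

text \<open>\<open>\<lambda>f d e' b'. d (\<lambda>x. f x e' b') b'\<close>\<close>
definition kleisli :: "ty \<Rightarrow> tm" where
  "kleisli A = Lam (Iota \<rightarrowtail> ChD A Iota) (Lam (ChD A Iota)
    (Lam (Iota \<rightarrowtail> A) (Lam ((Iota \<rightarrowtail> A) \<rightarrowtail> Iota \<rightarrowtail> A)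
      (Var 2 \<cdot> Lam Iota (Var 4 \<cdot> Var 0 \<cdot> Var 2 \<cdot> Var 1) \<cdot> Var 0))))"

text \<open>\<open>\<lambda>f. K (\<lambda>x. \<eta> (f x))\<close>\<close>
definition mapT :: "ty \<Rightarrow> tm" where
  "mapT A = Lam (Iota \<rightarrowtail> Iota) (kleisli A \<cdot> Lam Iota (eta A \<cdot> (Var 1 \<cdot> Var 0)))"

primrec trans_ty :: "ty \<Rightarrow> ty \<Rightarrow> ty" where
  "trans_ty A Iota = ChD A Iota"
| "trans_ty A (\<sigma> \<rightarrowtail> \<tau>) = trans_ty A \<sigma> \<rightarrowtail> trans_ty A \<tau>"

text \<open>At a function type: \<open>\<lambda>f d s. ext (\<lambda>x. f x s) d\<close>\<close>
primrec extT :: "ty \<Rightarrow> ty \<Rightarrow> tm" where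
  "extT A Iota = kleisli A"
| "extT A (\<sigma> \<rightarrowtail> \<tau>) =
    Lam (Iota \<rightarrowtail> trans_ty A (\<sigma> \<rightarrowtail> \<tau>)) (Lam (ChD A Iota) (Lam (trans_ty A \<sigma>)
      (extT A \<tau> \<cdot> Lam Iota (Var 3 \<cdot> Var 0 \<cdot> Var 1) \<cdot> Var 1)))"

primrec trans_tm :: "ty \<Rightarrow> tm \<Rightarrow> tm" where
  "trans_tm A (Var i) = Var i"
| "trans_tm A Zero = eta A \<cdot> Zero"
| "trans_tm A (Succ t) = mapT A \<cdot> Lam Iota (Succ (Var 0)) \<cdot> trans_tm A t"
| "trans_tm A (Rec \<sigma> t p q) =
    extT A \<sigma> \<cdot> Lam Iota (Rec (trans_ty A \<sigma>)
        (Lam Iota (lift 2 0 (trans_tm A t) \<cdot> (eta A \<cdot> Var 0))) (lift 1 0 (trans_tm A p)) (Var 0))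
      \<cdot> trans_tm A q"
| "trans_tm A (Lam \<sigma> t) = Lam (trans_ty A \<sigma>) (trans_tm A t)"
| "trans_tm A (t \<cdot> p) = trans_tm A t \<cdot> trans_tm A p"

definition generic :: "ty \<Rightarrow> tm" where
  "generic A = kleisli A \<cdot> Lam Iota (beta A \<cdot> eta A \<cdot> Var 0)"

definition dialogueTree :: "ty \<Rightarrow> tm \<Rightarrow> tm" where
  "dialogueTree A t = trans_tm A t \<cdot> generic A"

definition Pty :: ty where
  "Pty = (Iota \<rightarrowtail> Iota) \<rightarrowtail> Iota"

text \<open>\<open>\<lambda>d. d (\<lambda>z w. z) (\<lambda>\<phi> x \<alpha>. \<phi> (\<alpha> x) \<alpha>)\<close>\<close>
definition dialT :: tm where
  "dialT = Lam (ChD Pty Iota) (Var 0 \<cdot> Lam Iota (Lam (Iota \<rightarrowtail> Iota) (Var 1))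
    \<cdot> Lam (Iota \<rightarrowtail> Pty) (Lam Iota (Lam (Iota \<rightarrowtail> Iota) (Var 2 \<cdot> (Var 0 \<cdot> Var 1) \<cdot> Var 0))))"


subsection \<open>Typing of the translation\<close>

lemma has_type_VarI: "i < length \<Gamma> \<Longrightarrow> \<Gamma> ! i = \<sigma> \<Longrightarrow> has_type \<Gamma> (Var i) \<sigma>"
  using has_type.Var by blast

lemmas has_type_intros = has_type_VarI has_type.Zero has_type.Succ has_type.Rec has_type.Lam
  has_type.App

lemma has_type_eta: "has_type \<Gamma> (eta A) (Iota \<rightarrowtail> ChD A Iota)"
  unfolding eta_def ChD_def by (rule has_type_intros | simp)+

lemma has_type_beta: "has_type \<Gamma> (beta A) ((Iota \<rightarrowtail> ChD A Iota) \<rightarrowtail> Iota \<rightarrowtail> ChD A Iota)"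
  unfolding beta_def ChD_def by (rule has_type_intros | simp)+

lemma has_type_kleisli:
  "has_type \<Gamma> (kleisli A) ((Iota \<rightarrowtail> ChD A Iota) \<rightarrowtail> ChD A Iota \<rightarrowtail> ChD A Iota)"
  unfolding kleisli_def ChD_def by (rule has_type_intros | simp)+

lemma has_type_mapT: "has_type \<Gamma> (mapT A) ((Iota \<rightarrowtail> Iota) \<rightarrowtail> ChD A Iota \<rightarrowtail> ChD A Iota)"
  unfolding mapT_def by (rule has_type_kleisli has_type_eta has_type_intros | simp)+

lemma has_type_extT:
  "has_type \<Gamma> (extT A \<sigma>) ((Iota \<rightarrowtail> trans_ty A \<sigma>) \<rightarrowtail> ChD A Iota \<rightarrowtail> trans_ty A \<sigma>)"
proof (induction \<sigma> arbitrary: \<Gamma>)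
  case Iota
  then show ?case by (simp add: has_type_kleisli)
next
  case (Arr \<sigma> \<tau>)
  show ?case unfolding extT.simps trans_ty.simps
    by (rule Arr.IH has_type_intros | simp)+
qed

lemma has_type_lift:
  "has_type \<Gamma> t \<sigma> \<Longrightarrow> \<Gamma> = \<Gamma>1 @ \<Gamma>2 \<Longrightarrow> has_type (\<Gamma>1 @ \<Delta> @ \<Gamma>2) (lift (length \<Delta>) (length \<Gamma>1) t) \<sigma>"
proof (induction arbitrary: \<Gamma>1 rule: has_type.induct)
  case (Var i \<Gamma>)
  then show ?case by (auto intro!: has_type_VarI simp: nth_append)
next
  case (Lam \<sigma> \<Gamma> t \<tau>)
  then show ?case using Lam.IH[of "\<sigma> # \<Gamma>1"] by (auto intro: has_type.intros)
qed (auto intro: has_type.intros)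

lemma has_type_trans_tm: "has_type \<Gamma> t \<sigma> \<Longrightarrow> has_type (map (trans_ty A) \<Gamma>) (trans_tm A t) (trans_ty A \<sigma>)"
proof (induction rule: has_type.induct)
  case (Var i \<Gamma>)
  then show ?case by (auto intro!: has_type_VarI)
next
  case (Zero \<Gamma>)
  then show ?case by (auto intro: has_type.intros has_type_eta)
next
  case (Succ \<Gamma> t)
  have "has_type (map (trans_ty A) \<Gamma>) (Lam Iota (Succ (Var 0))) (Iota \<rightarrowtail> Iota)"
    by (rule has_type_intros | simp)+
  then show ?case using Succ by (auto intro: has_type.intros has_type_mapT)
next
  case (Rec \<Gamma> t \<sigma> p q)
  let ?G = "map (trans_ty A) \<Gamma>"
  have 1: "has_type (Iota # Iota # ?G) (lift 2 0 (trans_tm A t))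
      (ChD A Iota \<rightarrowtail> trans_ty A \<sigma> \<rightarrowtail> trans_ty A \<sigma>)"
    using has_type_lift[OF Rec.IH(1), of "[]" ?G "[Iota, Iota]"] by (simp add: numeral_2_eq_2)
  have 2: "has_type (Iota # ?G) (lift 1 0 (trans_tm A p)) (trans_ty A \<sigma>)"
    using has_type_lift[OF Rec.IH(2), of "[]" ?G "[Iota]"] by simp
  have 3: "has_type (Iota # Iota # ?G) (eta A \<cdot> Var 0) (ChD A Iota)"
    by (rule has_type_eta has_type_intros | simp)+
  have 4: "has_type (Iota # ?G) (Var 0) Iota"
    by (rule has_type_VarI) auto
  show ?case
    using has_type.App[OF has_type.App[OF has_type_extT
          has_type.Lam[OF has_type.Rec[OF has_type.Lam[OF has_type.App[OF 1 3]] 2 4]]]]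
      Rec.IH(3) by simp
qed (auto intro: has_type.intros)

lemma has_type_generic: "has_type \<Gamma> (generic A) (ChD A Iota \<rightarrowtail> ChD A Iota)"
  unfolding generic_def by (rule has_type_kleisli has_type_beta has_type_eta has_type_intros | simp)+

lemma has_type_dialT: "has_type \<Gamma> dialT (ChD Pty Iota \<rightarrowtail> Pty)"
  unfolding dialT_def ChD_def Pty_def by (rule has_type_intros | simp)+

lemma has_type_dialogueTree: "has_type [] t Pty \<Longrightarrow> has_type [] (dialogueTree A t) (ChD A Iota)"
  unfolding dialogueTree_def
  using has_type.App[OF _ has_type_generic] has_type_trans_tm[of "[]" t Pty A] by (simp add: Pty_def)

end

theory Submission
  imports Defs
begin

text \<open>
  Fix \<open>\<alpha>\<close> and let \<open>b\<close> be the value of \<open>\<lambda>\<phi> x \<alpha>. \<phi> (\<alpha> x) \<alpha>\<close>. A logical relation is defined between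
  \<open>\<lbrakk>\<sigma>\<rbrakk>\<close> and \<open>\<lbrakk>trans_ty P \<sigma>\<rbrakk>\<close>. At base type a number \<open>n\<close> is related to \<open>d\<close> if \<open>d e b \<alpha> = e n \<alpha>\<close> for
  every \<open>e\<close>. Quantifying over \<open>e\<close> makes the relation stable under the Kleisli extension, so that no
  inductive dialogue trees are needed; \<open>e = \<lambda>z w. z\<close> gives the theorem. The relation depends
  on \<open>P\<close> and \<open>\<alpha>\<close> only through the observation \<open>w \<mapsto> w \<alpha>\<close>, which is kept abstract.
\<close>

subsection \<open>The set interpretation\<close>

text \<open>The form in which the hypothesis of the theorem descends to subterms: the types met in a
  subterm, in its own context, are among those of the whole term.\<close>

definition standard_in :: "'v interp \<Rightarrow> ty list \<Rightarrow> tm \<Rightarrow> bool" where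
  "standard_in M \<Gamma> t \<longleftrightarrow> (\<forall>\<sigma> \<in> types_in \<Gamma> t. standard M \<sigma>)"

lemma standard_in_simps:
  "standard_in M \<Gamma> (Var i) \<longleftrightarrow> standard M (\<Gamma> ! i)"
  "standard_in M \<Gamma> Zero \<longleftrightarrow> standard M Iota"
  "standard_in M \<Gamma> (Succ t) \<longleftrightarrow> standard M Iota \<and> standard_in M \<Gamma> t"
  "standard_in M \<Gamma> (Rec \<sigma> t p q) \<longleftrightarrow>
    standard M \<sigma> \<and> standard_in M \<Gamma> t \<and> standard_in M \<Gamma> p \<and> standard_in M \<Gamma> q"
  "standard_in M \<Gamma> (Lam \<sigma> t) \<longleftrightarrow>
    standard M (\<sigma> \<rightarrowtail> type_of (\<sigma> # \<Gamma>) t) \<and> standard_in M (\<sigma> # \<Gamma>) t"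
  "standard_in M \<Gamma> (t \<cdot> p) \<longleftrightarrow>
    standard M (type_of \<Gamma> (t \<cdot> p)) \<and> standard_in M \<Gamma> t \<and> standard_in M \<Gamma> p"
  by (auto simp: standard_in_def)

text \<open>The type of a well-typed term belongs to its \<open>types_in\<close>, so every subterm
  brings the standardness of its own type and of all components of that type.\<close>

lemma standard_type: "standard_in M \<Gamma> t \<Longrightarrow> has_type \<Gamma> t \<sigma> \<Longrightarrow> standard M \<sigma>"
  by (cases t) (auto simp: standard_in_def dest!: type_of_eq)

lemma standard_subtypes: "standard M (\<sigma> \<rightarrowtail> \<tau>) \<Longrightarrow> standard M \<sigma>" "standard M (\<sigma> \<rightarrowtail> \<tau>) \<Longrightarrow> standard M \<tau>"
  by simp_all

lemma Num_in_El: "standard M Iota \<Longrightarrow> Num M n \<in> El M Iota"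
  by (auto simp: bij_betw_def)

lemma nat_of_Num: "standard M Iota \<Longrightarrow> nat_of M (Num M n) = n"
  by (auto simp: bij_betw_def nat_of_def inj_eq)

lemma Ap_in_El:
  assumes "standard M (\<sigma> \<rightarrowtail> \<tau>)" "f \<in> El M (\<sigma> \<rightarrowtail> \<tau>)" "x \<in> El M \<sigma>"
  shows "Ap M \<sigma> \<tau> f x \<in> El M \<tau>"
proof -
  have "bij_betw (\<lambda>v. restrict (Ap M \<sigma> \<tau> v) (El M \<sigma>)) (El M (\<sigma> \<rightarrowtail> \<tau>)) (El M \<sigma> \<rightarrow>\<^sub>E El M \<tau>)"
    using assms(1) by simp
  then have "restrict (Ap M \<sigma> \<tau> f) (El M \<sigma>) \<in> El M \<sigma> \<rightarrow>\<^sub>E El M \<tau>"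
    using assms(2) by (rule bij_betw_apply)
  then show ?thesis using assms(3) by (auto simp: PiE_iff)
qed

text \<open>\<open>Ap\<close> is a bijection from the carrier onto the extensional functions:
  surjectivity supplies the element that \<open>THE\<close> in \<open>Abs\<close> looks for,
  injectivity makes it unique. Restriction to \<open>El M \<sigma>\<close> turns agreement on the
  carrier into equality.\<close>

lemma Abs_props:
  assumes s: "standard M (\<sigma> \<rightarrowtail> \<tau>)" and f: "\<And>x. x \<in> El M \<sigma> \<Longrightarrow> f x \<in> El M \<tau>"
  shows Abs_in_El: "Abs M \<sigma> \<tau> f \<in> El M (\<sigma> \<rightarrowtail> \<tau>)"
    and Ap_Abs: "x \<in> El M \<sigma> \<Longrightarrow> Ap M \<sigma> \<tau> (Abs M \<sigma> \<tau> f) x = f x"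
proof -
  let ?r = "\<lambda>v. restrict (Ap M \<sigma> \<tau> v) (El M \<sigma>)"
  let ?P = "\<lambda>v. v \<in> El M (\<sigma> \<rightarrowtail> \<tau>) \<and> (\<forall>x \<in> El M \<sigma>. Ap M \<sigma> \<tau> v x = f x)"
  have b: "bij_betw ?r (El M (\<sigma> \<rightarrowtail> \<tau>)) (El M \<sigma> \<rightarrow>\<^sub>E El M \<tau>)"
    using s by simp
  have r: "restrict (Ap M \<sigma> \<tau> v) (El M \<sigma>) = restrict f (El M \<sigma>) \<longleftrightarrow> (\<forall>x \<in> El M \<sigma>. Ap M \<sigma> \<tau> v x = f x)" for v
    by (auto simp: restrict_def fun_eq_iff)
  have "restrict f (El M \<sigma>) \<in> El M \<sigma> \<rightarrow>\<^sub>E El M \<tau>" using f by auto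
  then obtain v where "v \<in> El M (\<sigma> \<rightarrowtail> \<tau>)" "restrict f (El M \<sigma>) = ?r v"
    using bij_betw_imp_surj_on[OF b] by blast
  then have "\<exists>!v. v \<in> El M (\<sigma> \<rightarrowtail> \<tau>) \<and> ?r v = restrict f (El M \<sigma>)"
    using inj_onD[OF bij_betw_imp_inj_on[OF b]] by (intro ex1I[of _ v]) simp_all
  then have "?P (Abs M \<sigma> \<tau> f)" unfolding Abs_def r by (rule theI')
  then show "Abs M \<sigma> \<tau> f \<in> El M (\<sigma> \<rightarrowtail> \<tau>)" "x \<in> El M \<sigma> \<Longrightarrow> Ap M \<sigma> \<tau> (Abs M \<sigma> \<tau> f) x = f x"
    by auto
qed

section \<open>Evaluation of well-typed terms\<close>

abbreviation in_env :: "'v interp \<Rightarrow> ty list \<Rightarrow> 'v list \<Rightarrow> bool" where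
  "in_env M \<Gamma> \<gamma> \<equiv> list_all2 (\<lambda>\<sigma> v. v \<in> El M \<sigma>) \<Gamma> \<gamma>"

lemma sem_App:
  "has_type \<Gamma> t (\<sigma> \<rightarrowtail> \<tau>) \<Longrightarrow> has_type \<Gamma> p \<sigma> \<Longrightarrow>
    sem M \<Gamma> (t \<cdot> p) \<gamma> = Ap M \<sigma> \<tau> (sem M \<Gamma> t \<gamma>) (sem M \<Gamma> p \<gamma>)"
  by (simp add: type_of_eq)

lemma sem_Rec_in_El:
  assumes "standard M (Iota \<rightarrowtail> \<sigma> \<rightarrowtail> \<sigma>)" "f \<in> El M (Iota \<rightarrowtail> \<sigma> \<rightarrowtail> \<sigma>)" "x \<in> El M \<sigma>"
  shows "rec_nat x (\<lambda>n y. Ap M \<sigma> \<sigma> (Ap M Iota (\<sigma> \<rightarrowtail> \<sigma>) f (Num M n)) y) n \<in> El M \<sigma>"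
proof (induction n)
  case (Suc n)
  have s: "standard M Iota" "standard M (\<sigma> \<rightarrowtail> \<sigma>)"
    using assms(1) by (auto dest: standard_subtypes)
  have "Ap M Iota (\<sigma> \<rightarrowtail> \<sigma>) f (Num M n) \<in> El M (\<sigma> \<rightarrowtail> \<sigma>)"
    using assms(1,2) Num_in_El[OF s(1)] by (rule Ap_in_El)
  then show ?case using Ap_in_El[OF s(2)] Suc by simp
qed (simp add: assms(3))

lemma sem_in_El:
  "has_type \<Gamma> t \<sigma> \<Longrightarrow> standard_in M \<Gamma> t \<Longrightarrow> in_env M \<Gamma> \<gamma> \<Longrightarrow> sem M \<Gamma> t \<gamma> \<in> El M \<sigma>"
proof (induction arbitrary: \<gamma> rule: has_type.induct)
  case (Var i \<Gamma>)
  then show ?case by (simp add: list_all2_conv_all_nth)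
next
  case (Rec \<Gamma> t \<sigma> p q)
  \<comment> \<open>\<open>Rec\<close> itself displays only \<sigma>; that the type of the step
    function is standard is read off from the subterm \<open>t\<close>.\<close>
  then have "standard_in M \<Gamma> t" by (simp add: standard_in_simps)
  then have "standard M (Iota \<rightarrowtail> \<sigma> \<rightarrowtail> \<sigma>)" using Rec.hyps(1) by (rule standard_type)
  then show ?case using Rec by (simp only: sem.simps standard_in_simps sem_Rec_in_El)
next
  case (Lam \<sigma> \<Gamma> t \<tau>)
  have "standard M (\<sigma> \<rightarrowtail> \<tau>)"
    using Lam.prems Lam.hyps by (simp add: standard_in_simps type_of_eq)
  then show ?case using Lam
    by (auto simp: type_of_eq standard_in_simps simp del: standard.simps intro!: Abs_in_El)
next
  case (App \<Gamma> t \<sigma> \<tau> p)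
  then have "standard M (\<sigma> \<rightarrowtail> \<tau>)" by (metis standard_in_simps(6) standard_type)
  then show ?case using App
    by (simp only: sem_App standard_in_simps Ap_in_El)
qed (auto simp: standard_in_simps simp del: standard.simps intro!: Num_in_El)

text \<open>Bundles the side conditions under which \<open>sem\<close> lands in the carrier, so that
  they travel as one fact while nested lambdas are opened.\<close>

definition typed_sem :: "'v interp \<Rightarrow> ty list \<Rightarrow> 'v list \<Rightarrow> tm \<Rightarrow> ty \<Rightarrow> bool" where
  "typed_sem M \<Gamma> \<gamma> t \<sigma> \<longleftrightarrow> has_type \<Gamma> t \<sigma> \<and> standard_in M \<Gamma> t \<and> in_env M \<Gamma> \<gamma>"

lemma typed_sem_in_El: "typed_sem M \<Gamma> \<gamma> t \<sigma> \<Longrightarrow> sem M \<Gamma> t \<gamma> \<in> El M \<sigma>"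
  by (simp add: typed_sem_def sem_in_El)

lemma typed_sem_standard: "typed_sem M \<Gamma> \<gamma> t \<sigma> \<Longrightarrow> standard M \<sigma>"
  unfolding typed_sem_def using standard_type by blast

inductive_cases has_type_LamE: "has_type \<Gamma> (Lam \<sigma> t) \<rho>"

text \<open>Chained by \<open>OF\<close>, this peels off nested lambdas one argument at a
  time.\<close>

lemma typed_sem_Lam:
  assumes "typed_sem M \<Gamma> \<gamma> (Lam \<sigma> t) (\<sigma> \<rightarrowtail> \<tau>)" "x \<in> El M \<sigma>"
  shows "typed_sem M (\<sigma> # \<Gamma>) (x # \<gamma>) t \<tau>"
  using assms by (auto simp: typed_sem_def standard_in_simps elim: has_type_LamE)

text \<open>Beta conversion. \<open>sem\<close> labels the abstraction with the computed
  \<open>type_of\<close> of the body, which typing identifies with \<tau>; the values of the body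
  stay in the carrier, so \<open>Abs\<close> represents it.\<close>

lemma Ap_sem_Lam:
  assumes l: "typed_sem M \<Gamma> \<gamma> (Lam \<sigma> t) (\<sigma> \<rightarrowtail> \<tau>)" and x: "x \<in> El M \<sigma>"
  shows "Ap M \<sigma> \<tau> (sem M \<Gamma> (Lam \<sigma> t) \<gamma>) x = sem M (\<sigma> # \<Gamma>) t (x # \<gamma>)"
proof -
  have "type_of (\<sigma> # \<Gamma>) t = \<tau>"
    using typed_sem_Lam[OF l x] by (simp add: typed_sem_def type_of_eq)
  then show ?thesis
    using typed_sem_standard[OF l] typed_sem_in_El[OF typed_sem_Lam[OF l]] x
    by (simp add: Ap_Abs del: standard.simps)
qed

section \<open>Weakening\<close>

lemma type_of_lift: "type_of (\<Gamma>1 @ \<Delta> @ \<Gamma>2) (lift (length \<Delta>) (length \<Gamma>1) t) = type_of (\<Gamma>1 @ \<Gamma>2) t"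
proof (induction t arbitrary: \<Gamma>1)
  case (Lam \<sigma> t)
  then show ?case using Lam[of "\<sigma> # \<Gamma>1"] by simp
qed (auto simp: nth_append)

text \<open>The translation of \<open>Rec\<close> lifts its arguments; this carries standardness
  back from the lifted terms to the original ones.\<close>

lemma types_in_lift: "types_in (\<Gamma>1 @ \<Delta> @ \<Gamma>2) (lift (length \<Delta>) (length \<Gamma>1) t) = types_in (\<Gamma>1 @ \<Gamma>2) t"
proof (induction t arbitrary: \<Gamma>1)
  case (Lam \<sigma> t)
  then show ?case
    using Lam[of "\<sigma> # \<Gamma>1"] type_of_lift[of "\<sigma> # \<Gamma>1" \<Delta> \<Gamma>2 t] by simp
qed (auto simp: nth_append type_of_lift)

text \<open>The prefix \<Gamma>1 contains the variables bound inside the term, so the lambda case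
  extends it together with \<gamma>1. The annotations that \<open>sem\<close> computes agree by
  \<open>type_of_lift\<close>.\<close>

lemma sem_lift:
  "length \<gamma>1 = length \<Gamma>1 \<Longrightarrow> length \<delta> = length \<Delta> \<Longrightarrow>
    sem M (\<Gamma>1 @ \<Delta> @ \<Gamma>2) (lift (length \<Delta>) (length \<Gamma>1) t) (\<gamma>1 @ \<delta> @ \<gamma>2)
      = sem M (\<Gamma>1 @ \<Gamma>2) t (\<gamma>1 @ \<gamma>2)"
proof (induction t arbitrary: \<Gamma>1 \<gamma>1)
  case (Lam \<sigma> t)
  have "sem M (\<sigma> # \<Gamma>1 @ \<Delta> @ \<Gamma>2) (lift (length \<Delta>) (Suc (length \<Gamma>1)) t) (x # \<gamma>1 @ \<delta> @ \<gamma>2)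
      = sem M (\<sigma> # \<Gamma>1 @ \<Gamma>2) t (x # \<gamma>1 @ \<gamma>2)" for x
    using Lam.IH[of "x # \<gamma>1" "\<sigma> # \<Gamma>1"] Lam.prems by simp
  then show ?case using type_of_lift[of "\<sigma> # \<Gamma>1" \<Delta> \<Gamma>2 t] by simp
qed (auto simp: nth_append type_of_lift)

lemma seq_props:
  assumes s: "standard M (Iota \<rightarrowtail> Iota)"
  shows seq_in_El: "seq M \<alpha> \<in> El M (Iota \<rightarrowtail> Iota)"
    and Ap_seq: "Ap M Iota Iota (seq M \<alpha>) (Num M n) = Num M (\<alpha> n)"
proof -
  have i: "standard M Iota" using s by simp
  show "seq M \<alpha> \<in> El M (Iota \<rightarrowtail> Iota)" unfolding seq_def using s
    by (rule Abs_in_El) (rule Num_in_El[OF i])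
  show "Ap M Iota Iota (seq M \<alpha>) (Num M n) = Num M (\<alpha> n)"
    unfolding seq_def using Ap_Abs[OF s] i by (simp add: Num_in_El nat_of_Num del: standard.simps)
qed


subsection \<open>The operations on internal dialogue trees\<close>

text \<open>With \<open>d\<close> read as a Church-encoded tree, \<open>e\<close> interprets its
  leaves and \<open>b\<close> its query nodes.\<close>

definition run :: "'v interp \<Rightarrow> ty \<Rightarrow> 'v \<Rightarrow> 'v \<Rightarrow> 'v \<Rightarrow> 'v" where
  "run M A d e b = Ap M ((Iota \<rightarrowtail> A) \<rightarrowtail> Iota \<rightarrowtail> A) A
    (Ap M (Iota \<rightarrowtail> A) (((Iota \<rightarrowtail> A) \<rightarrowtail> Iota \<rightarrowtail> A) \<rightarrowtail> A) d e) b"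

lemma run_eta:
  assumes s: "standard_in M \<Gamma> (eta A)" and g: "in_env M \<Gamma> \<gamma>" and x: "x \<in> El M Iota"
    and e: "e \<in> El M (Iota \<rightarrowtail> A)" and b: "b \<in> El M ((Iota \<rightarrowtail> A) \<rightarrowtail> Iota \<rightarrowtail> A)"
  shows "run M A (Ap M Iota (ChD A Iota) (sem M \<Gamma> (eta A) \<gamma>) x) e b = Ap M Iota A e x"
proof -
  have 1: "typed_sem M \<Gamma> \<gamma> (eta A) (Iota \<rightarrowtail> ChD A Iota)"
    using s g has_type_eta by (simp add: typed_sem_def)
  note 1 = 1[unfolded eta_def ChD_def]
  note 2 = typed_sem_Lam[OF 1 x]
  note 3 = typed_sem_Lam[OF 2 e]
  show ?thesis
    unfolding run_def eta_def ChD_def Ap_sem_Lam[OF 1 x] Ap_sem_Lam[OF 2 e] Ap_sem_Lam[OF 3 b]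
    by simp
qed

text \<open>Both \<open>kleisli\<close> and \<open>beta\<close> pass on the function \<open>\<lambda>x. f x e b\<close>.\<close>

lemma sem_run_fun:
  fixes M :: "'v interp"
  defines "\<Delta> A \<equiv> [(Iota \<rightarrowtail> A) \<rightarrowtail> Iota \<rightarrowtail> A, Iota \<rightarrowtail> A]"
  assumes s: "standard_in M (\<Delta> A @ \<rho> # (Iota \<rightarrowtail> ChD A Iota) # \<Gamma>)
      (Lam Iota (Var 4 \<cdot> Var 0 \<cdot> Var 2 \<cdot> Var 1))"
    and g: "in_env M (\<Delta> A @ \<rho> # (Iota \<rightarrowtail> ChD A Iota) # \<Gamma>) (b # e # d # f # \<gamma>)"
  defines "k \<equiv> sem M (\<Delta> A @ \<rho> # (Iota \<rightarrowtail> ChD A Iota) # \<Gamma>)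
      (Lam Iota (Var 4 \<cdot> Var 0 \<cdot> Var 2 \<cdot> Var 1)) (b # e # d # f # \<gamma>)"
  shows "k \<in> El M (Iota \<rightarrowtail> A)"
    and "x \<in> El M Iota \<Longrightarrow> Ap M Iota A k x = run M A (Ap M Iota (ChD A Iota) f x) e b"
proof -
  \<comment> \<open>Under the binder of x, variables 4, 2 and 1 are \<open>f\<close>,
    \<open>e\<close> and \<open>b\<close>. Variable 3, of type \<rho>, is the tree in
    \<open>kleisli\<close> and the query index in \<open>beta\<close>.\<close>
  have "has_type (\<Delta> A @ \<rho> # (Iota \<rightarrowtail> ChD A Iota) # \<Gamma>)
      (Lam Iota (Var 4 \<cdot> Var 0 \<cdot> Var 2 \<cdot> Var 1)) (Iota \<rightarrowtail> A)"
    unfolding \<Delta>_def ChD_def by (rule has_type_intros | simp)+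
  then have 1: "typed_sem M (\<Delta> A @ \<rho> # (Iota \<rightarrowtail> ChD A Iota) # \<Gamma>) (b # e # d # f # \<gamma>)
      (Lam Iota (Var 4 \<cdot> Var 0 \<cdot> Var 2 \<cdot> Var 1)) (Iota \<rightarrowtail> A)"
    using s g by (simp add: typed_sem_def)
  show "k \<in> El M (Iota \<rightarrowtail> A)" unfolding k_def using 1 by (rule typed_sem_in_El)
  show "Ap M Iota A k x = run M A (Ap M Iota (ChD A Iota) f x) e b" if "x \<in> El M Iota"
    unfolding k_def Ap_sem_Lam[OF 1 that] by (simp add: \<Delta>_def run_def ChD_def)
qed

text \<open>Only the interpretation of the leaves changes, from \<open>e\<close> to
  \<open>k\<close>, while \<open>b\<close> is kept; hence the relation below can fix
  \<open>b\<close> but has to range over \<open>e\<close>. Only the values of \<open>k\<close>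
  matter later, so its term is hidden by \<open>obtains\<close>.\<close>

lemma run_kleisli:
  assumes s: "standard_in M \<Gamma> (kleisli A)" and g: "in_env M \<Gamma> \<gamma>"
    and f: "f \<in> El M (Iota \<rightarrowtail> ChD A Iota)" and d: "d \<in> El M (ChD A Iota)"
    and e: "e \<in> El M (Iota \<rightarrowtail> A)" and b: "b \<in> El M ((Iota \<rightarrowtail> A) \<rightarrowtail> Iota \<rightarrowtail> A)"
  obtains k where "k \<in> El M (Iota \<rightarrowtail> A)"
    "\<And>x. x \<in> El M Iota \<Longrightarrow> Ap M Iota A k x = run M A (Ap M Iota (ChD A Iota) f x) e b"
    "run M A (Ap M (ChD A Iota) (ChD A Iota)
        (Ap M (Iota \<rightarrowtail> ChD A Iota) (ChD A Iota \<rightarrowtail> ChD A Iota) (sem M \<Gamma> (kleisli A) \<gamma>) f) d) e b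
      = run M A d k b"
proof -
  let ?B = "(Iota \<rightarrowtail> A) \<rightarrowtail> Iota \<rightarrowtail> A"
  let ?C = "(Iota \<rightarrowtail> A) \<rightarrowtail> ?B \<rightarrowtail> A"
  let ?\<Delta> = "?B # (Iota \<rightarrowtail> A) # ?C # (Iota \<rightarrowtail> ?C) # \<Gamma>"
  let ?L = "Lam Iota (Var 4 \<cdot> Var 0 \<cdot> Var 2 \<cdot> Var 1)"
  let ?k = "sem M ?\<Delta> ?L (b # e # d # f # \<gamma>)"
  note f = f[unfolded ChD_def] and d = d[unfolded ChD_def]
  have 1: "typed_sem M \<Gamma> \<gamma> (kleisli A) ((Iota \<rightarrowtail> ChD A Iota) \<rightarrowtail> ChD A Iota \<rightarrowtail> ChD A Iota)"
    using s g has_type_kleisli by (simp add: typed_sem_def)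
  note 1 = 1[unfolded kleisli_def ChD_def]
  note 2 = typed_sem_Lam[OF 1 f]
  note 3 = typed_sem_Lam[OF 2 d]
  note 4 = typed_sem_Lam[OF 3 e]
  note 5 = typed_sem_Lam[OF 4 b]
  have 6: "standard_in M ?\<Delta> ?L" "in_env M ?\<Delta> (b # e # d # f # \<gamma>)"
    using 5 unfolding typed_sem_def standard_in_simps(6) by blast+
  note k = sem_run_fun[where \<rho> = ?C and A = A and \<Gamma> = \<Gamma>, unfolded append.simps ChD_def, OF 6]
  \<comment> \<open>Four beta steps. The clause of \<open>sem\<close> for \<open>Lam\<close> is
    withheld from the simplifier so that the inner lambda survives as \<open>?k\<close>.\<close>
  have "run M A (Ap M ?C ?C (Ap M (Iota \<rightarrowtail> ?C) (?C \<rightarrowtail> ?C) (sem M \<Gamma> (kleisli A) \<gamma>) f) d) e b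
      = run M A d ?k b"
    unfolding kleisli_def ChD_def Ap_sem_Lam[OF 1 f] Ap_sem_Lam[OF 2 d] run_def
      Ap_sem_Lam[OF 3 e] Ap_sem_Lam[OF 4 b]
    by (simp del: sem.simps(5))
  with k show ?thesis by (rule that[unfolded ChD_def])
qed

text \<open>A query node hands to \<open>b\<close> its subtrees, already interpreted as
  \<open>k\<close>, and its index \<open>x\<close>.\<close>

lemma run_beta:
  assumes s: "standard_in M \<Gamma> (beta A)" and g: "in_env M \<Gamma> \<gamma>"
    and f: "f \<in> El M (Iota \<rightarrowtail> ChD A Iota)" and x: "x \<in> El M Iota"
    and e: "e \<in> El M (Iota \<rightarrowtail> A)" and b: "b \<in> El M ((Iota \<rightarrowtail> A) \<rightarrowtail> Iota \<rightarrowtail> A)"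
  obtains k where "k \<in> El M (Iota \<rightarrowtail> A)"
    "\<And>y. y \<in> El M Iota \<Longrightarrow> Ap M Iota A k y = run M A (Ap M Iota (ChD A Iota) f y) e b"
    "run M A (Ap M Iota (ChD A Iota)
        (Ap M (Iota \<rightarrowtail> ChD A Iota) (Iota \<rightarrowtail> ChD A Iota) (sem M \<Gamma> (beta A) \<gamma>) f) x) e b
      = Ap M Iota A (Ap M (Iota \<rightarrowtail> A) (Iota \<rightarrowtail> A) b k) x"
proof -
  let ?B = "(Iota \<rightarrowtail> A) \<rightarrowtail> Iota \<rightarrowtail> A"
  let ?C = "(Iota \<rightarrowtail> A) \<rightarrowtail> ?B \<rightarrowtail> A"
  let ?\<Delta> = "?B # (Iota \<rightarrowtail> A) # Iota # (Iota \<rightarrowtail> ?C) # \<Gamma>"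
  let ?L = "Lam Iota (Var 4 \<cdot> Var 0 \<cdot> Var 2 \<cdot> Var 1)"
  let ?k = "sem M ?\<Delta> ?L (b # e # x # f # \<gamma>)"
  note f = f[unfolded ChD_def]
  have 1: "typed_sem M \<Gamma> \<gamma> (beta A) ((Iota \<rightarrowtail> ChD A Iota) \<rightarrowtail> Iota \<rightarrowtail> ChD A Iota)"
    using s g has_type_beta by (simp add: typed_sem_def)
  note 1 = 1[unfolded beta_def ChD_def]
  note 2 = typed_sem_Lam[OF 1 f]
  note 3 = typed_sem_Lam[OF 2 x]
  note 4 = typed_sem_Lam[OF 3 e]
  note 5 = typed_sem_Lam[OF 4 b]
  have 6: "standard_in M ?\<Delta> ?L" "in_env M ?\<Delta> (b # e # x # f # \<gamma>)"
    using 5 unfolding typed_sem_def standard_in_simps(6) by blast+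
  note k = sem_run_fun[where \<rho> = Iota and A = A and \<Gamma> = \<Gamma>, unfolded append.simps ChD_def, OF 6]
  have "run M A (Ap M Iota ?C (Ap M (Iota \<rightarrowtail> ?C) (Iota \<rightarrowtail> ?C) (sem M \<Gamma> (beta A) \<gamma>) f) x) e b
      = Ap M Iota A (Ap M (Iota \<rightarrowtail> A) (Iota \<rightarrowtail> A) b ?k) x"
    unfolding beta_def ChD_def Ap_sem_Lam[OF 1 f] Ap_sem_Lam[OF 2 x] run_def
      Ap_sem_Lam[OF 3 e] Ap_sem_Lam[OF 4 b]
    by (simp del: sem.simps(5))
  with k show ?thesis by (rule that[unfolded ChD_def])
qed


subsection \<open>The logical relation\<close>

text \<open>In the theorem, \<open>a\<close> represents \<alpha>, \<open>obs\<close> is evaluation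
  at \<open>a\<close>, and \<open>b\<close> is the second argument that \<open>dialT\<close> gives
  to a tree. The law says that, under observation, \<open>b\<close> answers the query
  \<open>x\<close> with the value of \<open>a\<close> at \<open>x\<close>.\<close>

locale observation =
  fixes M :: "'v interp" and A :: ty and obs :: "'v \<Rightarrow> 'v" and a b :: 'v
  assumes standard_seq: "standard M (Iota \<rightarrowtail> Iota)"
    and a: "a \<in> El M (Iota \<rightarrowtail> Iota)"
    and b: "b \<in> El M ((Iota \<rightarrowtail> A) \<rightarrowtail> Iota \<rightarrowtail> A)"
    and obs: "\<lbrakk>f \<in> El M (Iota \<rightarrowtail> A); x \<in> El M Iota\<rbrakk> \<Longrightarrow>
      obs (Ap M Iota A (Ap M (Iota \<rightarrowtail> A) (Iota \<rightarrowtail> A) b f) x) = obs (Ap M Iota A f (Ap M Iota Iota a x))"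
begin

text \<open>Membership in both carriers is part of each clause, since beta conversion is available
  for such values only. The base clause compares observations because \<open>b\<close> is known only
  through \<open>obs\<close>.\<close>

primrec related :: "ty \<Rightarrow> 'v \<Rightarrow> 'v \<Rightarrow> bool" where
  "related Iota v d \<longleftrightarrow> v \<in> El M Iota \<and> d \<in> El M (ChD A Iota) \<and>
    (\<forall>e \<in> El M (Iota \<rightarrowtail> A). obs (run M A d e b) = obs (Ap M Iota A e v))"
| "related (\<sigma> \<rightarrowtail> \<tau>) v d \<longleftrightarrow> v \<in> El M (\<sigma> \<rightarrowtail> \<tau>) \<and> d \<in> El M (trans_ty A (\<sigma> \<rightarrowtail> \<tau>)) \<and>
    (\<forall>x y. related \<sigma> x y \<longrightarrow>
      related \<tau> (Ap M \<sigma> \<tau> v x) (Ap M (trans_ty A \<sigma>) (trans_ty A \<tau>) d y))"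

lemma related_in_El:
  assumes "related \<sigma> v d"
  shows "v \<in> El M \<sigma>" "d \<in> El M (trans_ty A \<sigma>)"
  using assms by (cases \<sigma>; simp)+

lemma related_Ap:
  "related (\<sigma> \<rightarrowtail> \<tau>) f f' \<Longrightarrow> related \<sigma> x x' \<Longrightarrow>
    related \<tau> (Ap M \<sigma> \<tau> f x) (Ap M (trans_ty A \<sigma>) (trans_ty A \<tau>) f' x')"
  by simp

section \<open>Compatibility of the relation with the operations on trees\<close>

lemma related_eta:
  assumes s: "standard_in M \<Gamma> (eta A)" and g: "in_env M \<Gamma> \<gamma>" and x: "x \<in> El M Iota"
  shows "related Iota x (Ap M Iota (ChD A Iota) (sem M \<Gamma> (eta A) \<gamma>) x)"
proof -
  have 1: "typed_sem M \<Gamma> \<gamma> (eta A) (Iota \<rightarrowtail> ChD A Iota)"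
    using s g has_type_eta by (simp add: typed_sem_def)
  then show ?thesis
    using Ap_in_El[OF typed_sem_standard[OF 1] typed_sem_in_El[OF 1] x]
    by (simp add: x run_eta[OF s g x _ b])
qed

text \<open>Let \<open>k\<close> be \<lambda>x. f x e b. Then K f d e b = d k b is observed as k v,
  by the relation of \<open>v\<close> and \<open>d\<close> taken at \<open>k\<close>; and k v = f v
  e b is observed as e w. So \<open>f\<close> has to be controlled only at the number
  \<open>v\<close>.\<close>

lemma related_kleisli:
  assumes s: "standard_in M \<Gamma> (kleisli A)" and g: "in_env M \<Gamma> \<gamma>"
    and f: "f \<in> El M (Iota \<rightarrowtail> ChD A Iota)"
    and d: "related Iota v d" and w: "related Iota w (Ap M Iota (ChD A Iota) f v)"
  shows "related Iota w (Ap M (ChD A Iota) (ChD A Iota)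
    (Ap M (Iota \<rightarrowtail> ChD A Iota) (ChD A Iota \<rightarrowtail> ChD A Iota) (sem M \<Gamma> (kleisli A) \<gamma>) f) d)"
    (is "related _ _ ?K")
proof -
  have 1: "typed_sem M \<Gamma> \<gamma> (kleisli A) ((Iota \<rightarrowtail> ChD A Iota) \<rightarrowtail> ChD A Iota \<rightarrowtail> ChD A Iota)"
    using s g has_type_kleisli by (simp add: typed_sem_def)
  have d': "v \<in> El M Iota" "d \<in> El M (ChD A Iota)"
    using d by auto
  have K: "?K \<in> El M (ChD A Iota)"
    using typed_sem_standard[OF 1]
    by (intro Ap_in_El typed_sem_in_El[OF 1] f d') (auto dest: standard_subtypes)
  have "obs (run M A ?K e b) = obs (Ap M Iota A e w)" if e: "e \<in> El M (Iota \<rightarrowtail> A)" for e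
  proof (rule run_kleisli[OF s g f d'(2) e b])
    fix k assume k: "k \<in> El M (Iota \<rightarrowtail> A)"
      "\<And>x. x \<in> El M Iota \<Longrightarrow> Ap M Iota A k x = run M A (Ap M Iota (ChD A Iota) f x) e b"
      "run M A ?K e b = run M A d k b"
    have "obs (run M A ?K e b) = obs (Ap M Iota A k v)" using k d by simp
    then show ?thesis using k(2)[OF d'(1)] w e by simp
  qed
  then show ?thesis using K w by simp
qed

text \<open>At a function type the extension acts argumentwise: ext f d y = ext (\<lambda>x. f x y)
  d. The induction varies \<Gamma> because the inner extension sees three more variables, and
  \<open>f\<close> and \<open>w\<close> because they become \<lambda>x. f x y and the value of
  \<open>w\<close> at the argument related to \<open>y\<close>.\<close>

lemma related_extT:
  assumes "standard_in M \<Gamma> (extT A \<sigma>)" "in_env M \<Gamma> \<gamma>" "f \<in> El M (Iota \<rightarrowtail> trans_ty A \<sigma>)"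
    and "related Iota v d" "related \<sigma> w (Ap M Iota (trans_ty A \<sigma>) f v)"
  shows "related \<sigma> w (Ap M (ChD A Iota) (trans_ty A \<sigma>)
    (Ap M (Iota \<rightarrowtail> trans_ty A \<sigma>) (ChD A Iota \<rightarrowtail> trans_ty A \<sigma>) (sem M \<Gamma> (extT A \<sigma>) \<gamma>) f) d)"
  using assms
proof (induction \<sigma> arbitrary: \<Gamma> \<gamma> f w)
  case Iota
  then show ?case unfolding trans_ty.simps extT.simps by (rule related_kleisli)
next
  case (Arr \<sigma> \<tau>)
  let ?L = "Lam Iota (Var 3 \<cdot> Var 0 \<cdot> Var 1)"
  let ?\<Delta> = "trans_ty A \<sigma> # ChD A Iota # (Iota \<rightarrowtail> trans_ty A (\<sigma> \<rightarrowtail> \<tau>)) # \<Gamma>"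
  note f = Arr.prems(3)
  have d: "v \<in> El M Iota" "d \<in> El M (ChD A Iota)"
    using Arr.prems(4) by auto
  have 1: "typed_sem M \<Gamma> \<gamma> (extT A (\<sigma> \<rightarrowtail> \<tau>))
      ((Iota \<rightarrowtail> trans_ty A (\<sigma> \<rightarrowtail> \<tau>)) \<rightarrowtail> ChD A Iota \<rightarrowtail> trans_ty A (\<sigma> \<rightarrowtail> \<tau>))"
    using Arr.prems(1,2) has_type_extT unfolding typed_sem_def by blast
  let ?E = "Ap M (ChD A Iota) (trans_ty A (\<sigma> \<rightarrowtail> \<tau>)) (Ap M (Iota \<rightarrowtail> trans_ty A (\<sigma> \<rightarrowtail> \<tau>))
      (ChD A Iota \<rightarrowtail> trans_ty A (\<sigma> \<rightarrowtail> \<tau>)) (sem M \<Gamma> (extT A (\<sigma> \<rightarrowtail> \<tau>)) \<gamma>) f) d"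
  have E: "?E \<in> El M (trans_ty A (\<sigma> \<rightarrowtail> \<tau>))"
    using typed_sem_standard[OF 1]
    by (intro Ap_in_El typed_sem_in_El[OF 1] f d) (auto dest: standard_subtypes)
  note 1 = 1[unfolded extT.simps]
  note 2 = typed_sem_Lam[OF 1 f]
  note 3 = typed_sem_Lam[OF 2 d(2), unfolded trans_ty.simps(2)]
  have "related \<tau> (Ap M \<sigma> \<tau> w x) (Ap M (trans_ty A \<sigma>) (trans_ty A \<tau>) ?E y)"
    if xy: "related \<sigma> x y" for x y
  proof -
    note y = related_in_El(2)[OF xy]
    note 4 = typed_sem_Lam[OF 3 y]
    let ?\<delta> = "y # d # f # \<gamma>"
    have L: "has_type ?\<Delta> ?L (Iota \<rightarrowtail> trans_ty A \<tau>)"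
      by (rule has_type_intros | simp)+
    have s: "standard_in M ?\<Delta> (extT A \<tau>)" "standard_in M ?\<Delta> ?L" "in_env M ?\<Delta> ?\<delta>"
      using 4 unfolding typed_sem_def standard_in_simps(6) trans_ty.simps(2) by blast+
    have 5: "typed_sem M ?\<Delta> ?\<delta> ?L (Iota \<rightarrowtail> trans_ty A \<tau>)"
      using L s by (simp add: typed_sem_def)
    \<comment> \<open>The premise of the induction hypothesis for \<tau>: the new function
      \<open>?L\<close> sends \<open>v\<close> to f v y.\<close>
    have "related \<tau> (Ap M \<sigma> \<tau> w x) (Ap M Iota (trans_ty A \<tau>) (sem M ?\<Delta> ?L ?\<delta>) v)"
      unfolding Ap_sem_Lam[OF 5 d(1)] using Arr.prems(5) xy by simp
    note ih = Arr.IH(2)[OF s(1,3) typed_sem_in_El[OF 5] Arr.prems(4) this]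
    have "Ap M (trans_ty A \<sigma>) (trans_ty A \<tau>) ?E y = sem M ?\<Delta> (extT A \<tau> \<cdot> ?L \<cdot> Var 1) ?\<delta>"
      unfolding extT.simps Ap_sem_Lam[OF 1 f]
      unfolding Ap_sem_Lam[OF 2 d(2)] unfolding trans_ty.simps(2) Ap_sem_Lam[OF 3 y] ..
    also have "\<dots> = Ap M (ChD A Iota) (trans_ty A \<tau>) (Ap M (Iota \<rightarrowtail> trans_ty A \<tau>)
      (ChD A Iota \<rightarrowtail> trans_ty A \<tau>) (sem M ?\<Delta> (extT A \<tau>) ?\<delta>) (sem M ?\<Delta> ?L ?\<delta>)) d"
      using sem_App[OF has_type_extT L] type_of_eq[OF has_type_extT] by simp
    finally show ?thesis using ih by simp
  qed
  then show ?case using E related_in_El(1)[OF Arr.prems(5)] by simp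
qed

text \<open>Kleisli extension reduces the claim to a single query: \<beta> \<eta> x e b = b k x is
  observed as k (a x) by the law of the locale, and \<open>k\<close> = \<lambda>y. \<eta> y e b
  takes the same values as \<open>e\<close>.\<close>

lemma related_generic:
  assumes s: "standard_in M \<Gamma> (generic A)" and g: "in_env M \<Gamma> \<gamma>"
  shows "related (Iota \<rightarrowtail> Iota) a (sem M \<Gamma> (generic A) \<gamma>)"
proof -
  let ?L = "Lam Iota (beta A \<cdot> eta A \<cdot> Var 0)"
  have L: "has_type \<Gamma> ?L (Iota \<rightarrowtail> ChD A Iota)"
    by (rule has_type_beta has_type_eta has_type_intros | simp)+
  have 1: "typed_sem M \<Gamma> \<gamma> (generic A) (ChD A Iota \<rightarrowtail> ChD A Iota)"
    using s g has_type_generic by (simp add: typed_sem_def)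
  have sK: "standard_in M \<Gamma> (kleisli A)" and 2: "typed_sem M \<Gamma> \<gamma> ?L (Iota \<rightarrowtail> ChD A Iota)"
    using s g L unfolding generic_def standard_in_simps(6) typed_sem_def by blast+
  have G: "sem M \<Gamma> (generic A) \<gamma> =
      Ap M (Iota \<rightarrowtail> ChD A Iota) (ChD A Iota \<rightarrowtail> ChD A Iota) (sem M \<Gamma> (kleisli A) \<gamma>) (sem M \<Gamma> ?L \<gamma>)"
    unfolding generic_def by (rule sem_App[OF has_type_kleisli L])
  have "related Iota (Ap M Iota Iota a x) (Ap M (ChD A Iota) (ChD A Iota) (sem M \<Gamma> (generic A) \<gamma>) d)"
    if xd: "related Iota x d" for x d
    unfolding G
  proof (rule related_kleisli[OF sK g typed_sem_in_El[OF 2] xd])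
    have x: "x \<in> El M Iota" using xd by simp
    note 3 = typed_sem_Lam[OF 2 x]
    have s3: "standard_in M (Iota # \<Gamma>) (beta A)" "standard_in M (Iota # \<Gamma>) (eta A)"
        "in_env M (Iota # \<Gamma>) (x # \<gamma>)"
      using 3 unfolding typed_sem_def standard_in_simps(6) by blast+
    have eta: "sem M (Iota # \<Gamma>) (eta A) (x # \<gamma>) \<in> El M (Iota \<rightarrowtail> ChD A Iota)"
      by (rule sem_in_El[OF has_type_eta s3(2,3)])
    let ?B = "Ap M Iota (ChD A Iota)
        (Ap M (Iota \<rightarrowtail> ChD A Iota) (Iota \<rightarrowtail> ChD A Iota) (sem M (Iota # \<Gamma>) (beta A) (x # \<gamma>))
          (sem M (Iota # \<Gamma>) (eta A) (x # \<gamma>))) x"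
    have B: "Ap M Iota (ChD A Iota) (sem M \<Gamma> ?L \<gamma>) x = ?B"
      unfolding Ap_sem_Lam[OF 2 x]
      using type_of_eq[OF has_type_beta] type_of_eq[OF has_type_eta] by simp
    have "obs (run M A ?B e b) = obs (Ap M Iota A e (Ap M Iota Iota a x))"
      if e: "e \<in> El M (Iota \<rightarrowtail> A)" for e
    proof (rule run_beta[OF s3(1,3) eta x e b])
      fix k assume k: "k \<in> El M (Iota \<rightarrowtail> A)"
        "\<And>y. y \<in> El M Iota \<Longrightarrow> Ap M Iota A k y
          = run M A (Ap M Iota (ChD A Iota) (sem M (Iota # \<Gamma>) (eta A) (x # \<gamma>)) y) e b"
        "run M A ?B e b = Ap M Iota A (Ap M (Iota \<rightarrowtail> A) (Iota \<rightarrowtail> A) b k) x"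
      have "Ap M Iota A k (Ap M Iota Iota a x) = Ap M Iota A e (Ap M Iota Iota a x)"
        using k(2) run_eta[OF s3(2,3) _ e b] Ap_in_El[OF standard_seq a x] by simp
      then show ?thesis using obs[OF k(1) x] k(3) by simp
    qed
    moreover have "?B \<in> El M (ChD A Iota)"
      unfolding B[symmetric]
      by (rule Ap_in_El[OF typed_sem_standard[OF 2] typed_sem_in_El[OF 2] x])
    ultimately show "related Iota (Ap M Iota Iota a x) (Ap M Iota (ChD A Iota) (sem M \<Gamma> ?L \<gamma>) x)"
      unfolding B using Ap_in_El[OF standard_seq a x] by simp
  qed
  then show ?thesis
    using a typed_sem_in_El[OF 1] unfolding related.simps(2) trans_ty.simps by blast
qed

section \<open>Related environments and the fundamental lemma\<close>

definition related_env :: "ty list \<Rightarrow> 'v list \<Rightarrow> 'v list \<Rightarrow> bool" where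
  "related_env \<Gamma> \<gamma> \<delta> \<longleftrightarrow> length \<gamma> = length \<Gamma> \<and> length \<delta> = length \<Gamma> \<and>
    (\<forall>i < length \<Gamma>. related (\<Gamma> ! i) (\<gamma> ! i) (\<delta> ! i))"

lemma related_env_in_env:
  assumes "related_env \<Gamma> \<gamma> \<delta>"
  shows "in_env M \<Gamma> \<gamma>" "in_env M (map (trans_ty A) \<Gamma>) \<delta>"
  using assms by (auto simp: related_env_def list_all2_conv_all_nth dest: related_in_El)

lemma related_env_Nil: "related_env [] [] []"
  by (simp add: related_env_def)

lemma related_env_Cons:
  "related_env \<Gamma> \<gamma> \<delta> \<Longrightarrow> related \<sigma> v d \<Longrightarrow> related_env (\<sigma> # \<Gamma>) (v # \<gamma>) (d # \<delta>)"
  by (auto simp: related_env_def nth_Cons split: nat.split)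

text \<open>Where the source recursor passes a number to its step function, the translated one
  passes a tree, here \<open>h n\<close>, later \<eta> applied to the number. Both recursions run
  over the same external number.\<close>

lemma related_Rec:
  assumes f: "related (Iota \<rightarrowtail> \<sigma> \<rightarrowtail> \<sigma>) f f'" and x: "related \<sigma> x x'"
    and h: "\<And>n. related Iota (Num M n) (h n)"
  shows "related \<sigma>
    (rec_nat x (\<lambda>n y. Ap M \<sigma> \<sigma> (Ap M Iota (\<sigma> \<rightarrowtail> \<sigma>) f (Num M n)) y) n)
    (rec_nat x' (\<lambda>n y. Ap M (trans_ty A \<sigma>) (trans_ty A \<sigma>)
      (Ap M (ChD A Iota) (trans_ty A \<sigma> \<rightarrowtail> trans_ty A \<sigma>) f' (h n)) y) n)"
proof (induction n)
  case (Suc n)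
  have "related (\<sigma> \<rightarrowtail> \<sigma>) (Ap M Iota (\<sigma> \<rightarrowtail> \<sigma>) f (Num M n))
      (Ap M (ChD A Iota) (trans_ty A \<sigma> \<rightarrowtail> trans_ty A \<sigma>) f' (h n))"
    using related_Ap[OF f h] by (simp only: trans_ty.simps)
  then show ?case using Suc by simp
qed (simp add: x)

text \<open>Variables come from the environment, lambda and application from the clause for function
  types, numerals and recursion from the lemmas on \<eta>, K and ext. Each side has its own
  standardness hypothesis, since the translation involves other types.\<close>

lemma related_trans_tm:
  assumes "has_type \<Gamma> t \<sigma>" "standard_in M \<Gamma> t"
    and "standard_in M (map (trans_ty A) \<Gamma>) (trans_tm A t)" "related_env \<Gamma> \<gamma> \<delta>"
  shows "related \<sigma> (sem M \<Gamma> t \<gamma>) (sem M (map (trans_ty A) \<Gamma>) (trans_tm A t) \<delta>)"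
  using assms
proof (induction arbitrary: \<gamma> \<delta> rule: has_type.induct)
  case (Var i \<Gamma>)
  then show ?case by (simp add: related_env_def)
next
  case (Zero \<Gamma>)
  let ?G = "map (trans_ty A) \<Gamma>"
  have s: "standard_in M ?G (eta A)" and i: "standard M Iota"
    using Zero.prems(1,2) by (simp_all add: standard_in_simps del: standard.simps)
  have "sem M ?G (trans_tm A Zero) \<delta> = Ap M Iota (ChD A Iota) (sem M ?G (eta A) \<delta>) (Num M 0)"
    using sem_App[OF has_type_eta has_type.Zero] by simp
  then show ?case
    using related_eta[OF s related_env_in_env(2)[OF Zero.prems(3)] Num_in_El[OF i]] by simp
next
  case (Succ \<Gamma> t)
  let ?G = "map (trans_ty A) \<Gamma>"
  let ?S = "Lam Iota (Succ (Var 0))"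
  let ?L = "Lam Iota (eta A \<cdot> (Var 1 \<cdot> Var 0))"
  let ?f = "sem M ?G ?S \<delta>"
  let ?G' = "(Iota \<rightarrowtail> Iota) # ?G" and ?\<delta>' = "?f # \<delta>"
  note env = related_env_in_env(2)[OF Succ.prems(3)]
  have st: "standard_in M \<Gamma> t" and i: "standard M Iota"
    using Succ.prems(1) by (simp_all add: standard_in_simps del: standard.simps)
  have s: "standard_in M ?G (mapT A)" "standard_in M ?G ?S" "standard_in M ?G (trans_tm A t)"
    using Succ.prems(2) unfolding trans_tm.simps standard_in_simps(6) by blast+
  have S: "has_type ?G ?S (Iota \<rightarrowtail> Iota)" and L: "has_type ?G' ?L (Iota \<rightarrowtail> ChD A Iota)"
    by (rule has_type_eta has_type_intros | simp)+
  have 0: "typed_sem M ?G \<delta> ?S (Iota \<rightarrowtail> Iota)"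
    using S s(2) env by (simp add: typed_sem_def)
  note f = typed_sem_in_El[OF 0]
  have 1: "typed_sem M ?G \<delta> (mapT A) ((Iota \<rightarrowtail> Iota) \<rightarrowtail> ChD A Iota \<rightarrowtail> ChD A Iota)"
    using has_type_mapT s(1) env by (simp add: typed_sem_def)
  note 1 = 1[unfolded mapT_def]
  note 2 = typed_sem_Lam[OF 1 f]
  have s2: "standard_in M ?G' (kleisli A)" "standard_in M ?G' ?L" "in_env M ?G' ?\<delta>'"
    using 2 unfolding typed_sem_def standard_in_simps(6) by blast+
  have 3: "typed_sem M ?G' ?\<delta>' ?L (Iota \<rightarrowtail> ChD A Iota)"
    using L s2 by (simp add: typed_sem_def)
  have t: "has_type ?G (trans_tm A t) (ChD A Iota)"
    using has_type_trans_tm[OF Succ.hyps] by simp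
  have ih: "related Iota (sem M \<Gamma> t \<gamma>) (sem M ?G (trans_tm A t) \<delta>)"
    by (rule Succ.IH[OF st s(3) Succ.prems(3)])
  have v: "sem M \<Gamma> t \<gamma> \<in> El M Iota"
    using ih by simp
  note 4 = typed_sem_Lam[OF 3 v]
  have s4: "standard_in M (Iota # ?G') (eta A)" "in_env M (Iota # ?G') (sem M \<Gamma> t \<gamma> # ?\<delta>')"
    using 4 unfolding typed_sem_def standard_in_simps(6) by blast+
  \<comment> \<open>\<open>?L\<close> is the function \<lambda>x. \<eta> (f x) that
    \<open>mapT\<close> hands to K, with f the successor; at the value of \<open>t\<close> it yields
    \<eta> of the next number.\<close>
  have "Ap M Iota (ChD A Iota) (sem M ?G' ?L ?\<delta>') (sem M \<Gamma> t \<gamma>) = Ap M Iota (ChD A Iota)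
      (sem M (Iota # ?G') (eta A) (sem M \<Gamma> t \<gamma> # ?\<delta>')) (Ap M Iota Iota ?f (sem M \<Gamma> t \<gamma>))"
    unfolding Ap_sem_Lam[OF 3 v] using type_of_eq[OF has_type_eta] by (simp del: sem.simps(5))
  also have "Ap M Iota Iota ?f (sem M \<Gamma> t \<gamma>) = sem M \<Gamma> (Succ t) \<gamma>"
    unfolding Ap_sem_Lam[OF 0 v] by simp
  finally have "related Iota (sem M \<Gamma> (Succ t) \<gamma>)
      (Ap M Iota (ChD A Iota) (sem M ?G' ?L ?\<delta>') (sem M \<Gamma> t \<gamma>))"
    using related_eta[OF s4, of "sem M \<Gamma> (Succ t) \<gamma>"] Num_in_El[OF i] by simp
  note r = related_kleisli[OF s2(1,3) typed_sem_in_El[OF 3] ih this]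
  have "sem M ?G (trans_tm A (Succ t)) \<delta> = Ap M (ChD A Iota) (ChD A Iota)
      (Ap M (Iota \<rightarrowtail> Iota) (ChD A Iota \<rightarrowtail> ChD A Iota) (sem M ?G (mapT A) \<delta>) ?f)
      (sem M ?G (trans_tm A t) \<delta>)"
    unfolding trans_tm.simps sem_App[OF has_type.App[OF has_type_mapT S] t]
      sem_App[OF has_type_mapT S] ..
  also have "Ap M (Iota \<rightarrowtail> Iota) (ChD A Iota \<rightarrowtail> ChD A Iota) (sem M ?G (mapT A) \<delta>) ?f =
      Ap M (Iota \<rightarrowtail> ChD A Iota) (ChD A Iota \<rightarrowtail> ChD A Iota)
        (sem M ?G' (kleisli A) ?\<delta>') (sem M ?G' ?L ?\<delta>')"
    unfolding mapT_def Ap_sem_Lam[OF 1 f] sem_App[OF has_type_kleisli L] ..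
  finally show ?case using r by simp
next
  case (Rec \<Gamma> t \<sigma> p q)
  let ?G = "map (trans_ty A) \<Gamma>" and ?\<sigma> = "trans_ty A \<sigma>"
  let ?t = "trans_tm A t" and ?p = "trans_tm A p" and ?q = "trans_tm A q"
  let ?H = "Lam Iota (lift 2 0 ?t \<cdot> (eta A \<cdot> Var 0))"
  let ?R = "Rec ?\<sigma> ?H (lift 1 0 ?p) (Var 0)"
  let ?v = "sem M \<Gamma> q \<gamma>"
  let ?G1 = "Iota # ?G"
  note env = related_env_in_env(2)[OF Rec.prems(3)]
  have t: "has_type ?G ?t (ChD A Iota \<rightarrowtail> ?\<sigma> \<rightarrowtail> ?\<sigma>)" and p: "has_type ?G ?p ?\<sigma>"
    and q: "has_type ?G ?q (ChD A Iota)"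
    using Rec.hyps[THEN has_type_trans_tm, of A] by simp_all
  have lt: "has_type (Iota # ?G1) (lift 2 0 ?t) (ChD A Iota \<rightarrowtail> ?\<sigma> \<rightarrowtail> ?\<sigma>)"
    using has_type_lift[OF t, of "[]" ?G "[Iota, Iota]"] by (simp add: numeral_2_eq_2)
  have lp: "has_type ?G1 (lift 1 0 ?p) ?\<sigma>"
    using has_type_lift[OF p, of "[]" ?G "[Iota]"] by simp
  have e: "has_type (Iota # ?G1) (eta A \<cdot> Var 0) (ChD A Iota)"
    by (rule has_type_eta has_type_intros | simp)+
  have H: "has_type ?G1 ?H (Iota \<rightarrowtail> ?\<sigma> \<rightarrowtail> ?\<sigma>)"
    by (rule has_type.Lam[OF has_type.App[OF lt e]])
  have R: "has_type ?G (Lam Iota ?R) (Iota \<rightarrowtail> ?\<sigma>)"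
    by (rule has_type.Lam[OF has_type.Rec[OF H lp]]) (simp add: has_type_VarI)
  have s0: "standard_in M \<Gamma> t" "standard_in M \<Gamma> p" "standard_in M \<Gamma> q"
    using Rec.prems(1) unfolding standard_in_simps by blast+
  have i: "standard M Iota"
    using s0(3) Rec.hyps(3) by (rule standard_type)
  have s: "standard_in M ?G (extT A \<sigma>)" "standard_in M ?G (Lam Iota ?R)" "standard_in M ?G ?q"
    using Rec.prems(2) unfolding trans_tm.simps standard_in_simps(6) by blast+
  have 1: "typed_sem M ?G \<delta> (Lam Iota ?R) (Iota \<rightarrowtail> ?\<sigma>)"
    using R s(2) env by (simp add: typed_sem_def)
  have ihq: "related Iota ?v (sem M ?G ?q \<delta>)"
    by (rule Rec.IH(3)[OF s0(3) s(3) Rec.prems(3)])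
  then have v: "?v \<in> El M Iota" by simp
  note 2 = typed_sem_Lam[OF 1 v]
  have s2: "standard_in M ?G1 ?H" "standard_in M ?G1 (lift 1 0 ?p)" "in_env M ?G1 (?v # \<delta>)"
    using 2 unfolding typed_sem_def standard_in_simps(4) by blast+
  have 3: "typed_sem M ?G1 (?v # \<delta>) ?H (Iota \<rightarrowtail> ?\<sigma> \<rightarrowtail> ?\<sigma>)"
    using H s2 by (simp add: typed_sem_def)
  \<comment> \<open>The induction hypotheses concern the unlifted translations, while standardness
    is known for the lifted ones; lifting preserves the set of types.\<close>
  have st: "standard_in M ?G ?t"
    using s2(1) types_in_lift[of "[]" "[Iota, Iota]" ?G ?t]
    unfolding standard_in_simps by (simp add: standard_in_def numeral_2_eq_2)
  have sp: "standard_in M ?G ?p"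
    using s2(2) types_in_lift[of "[]" "[Iota]" ?G ?p] by (simp add: standard_in_def)
  note iht = Rec.IH(1)[OF s0(1) st Rec.prems(3)]
  note ihp = Rec.IH(2)[OF s0(2) sp Rec.prems(3)]
  \<comment> \<open>The body of \<open>?H\<close> is evaluated with two extra variables, the index
    of the current recursion step and the number \<open>?v\<close> recursed on. The lifted
    \<open>?t\<close> skips both.\<close>
  define h where "h n = Ap M Iota (ChD A Iota)
    (sem M (Iota # ?G1) (eta A) (Num M n # ?v # \<delta>)) (Num M n)" for n
  have H_Num: "Ap M Iota (?\<sigma> \<rightarrowtail> ?\<sigma>) (sem M ?G1 ?H (?v # \<delta>)) (Num M n)
      = Ap M (ChD A Iota) (?\<sigma> \<rightarrowtail> ?\<sigma>) (sem M ?G ?t \<delta>) (h n)" for n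
    using sem_lift[of "[]" "[]" "[Num M n, ?v]" "[Iota, Iota]" M ?G ?t \<delta>]
    unfolding Ap_sem_Lam[OF 3 Num_in_El[OF i]] sem_App[OF lt e]
    by (simp add: type_of_eq[OF has_type_eta] h_def numeral_2_eq_2)
  have h: "related Iota (Num M n) (h n)" for n
    unfolding h_def
  proof (rule related_eta[OF _ _ Num_in_El[OF i]])
    show "standard_in M (Iota # ?G1) (eta A)" "in_env M (Iota # ?G1) (Num M n # ?v # \<delta>)"
      using typed_sem_Lam[OF 3 Num_in_El[OF i, of n]]
      unfolding typed_sem_def standard_in_simps(6) by blast+
  qed
  \<comment> \<open>\<open>related_extT\<close> asks about its function only at \<open>?v\<close>,
    where the internal recursion runs over the same number as the source recursion.\<close>
  have "related \<sigma> (sem M \<Gamma> (Rec \<sigma> t p q) \<gamma>) (Ap M Iota ?\<sigma> (sem M ?G (Lam Iota ?R) \<delta>) ?v)"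
    using related_Rec[OF iht ihp h, of "nat_of M ?v"]
      sem_lift[of "[]" "[]" "[?v]" "[Iota]" M ?G ?p \<delta>]
    unfolding Ap_sem_Lam[OF 1 v] by (simp add: H_Num del: sem.simps(5))
  note r = related_extT[OF s(1) env typed_sem_in_El[OF 1] ihq this]
  show ?case
    unfolding trans_tm.simps sem_App[OF has_type.App[OF has_type_extT R] q]
      sem_App[OF has_type_extT R] by (rule r)
next
  case (Lam \<sigma> \<Gamma> t \<tau>)
  let ?G = "map (trans_ty A) \<Gamma>"
  have 1: "typed_sem M \<Gamma> \<gamma> (Lam \<sigma> t) (\<sigma> \<rightarrowtail> \<tau>)"
    using has_type.Lam[OF Lam.hyps] Lam.prems(1) related_env_in_env(1)[OF Lam.prems(3)]
    by (simp add: typed_sem_def)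
  have 2: "typed_sem M ?G \<delta> (Lam (trans_ty A \<sigma>) (trans_tm A t)) (trans_ty A \<sigma> \<rightarrowtail> trans_ty A \<tau>)"
    using has_type_trans_tm[OF has_type.Lam[OF Lam.hyps], of A] Lam.prems(2)
      related_env_in_env(2)[OF Lam.prems(3)]
    by (simp add: typed_sem_def)
  \<comment> \<open>Beta conversion on both sides leaves the two bodies in environments extended by
    the related arguments.\<close>
  have "related \<tau> (Ap M \<sigma> \<tau> (sem M \<Gamma> (Lam \<sigma> t) \<gamma>) x) (Ap M (trans_ty A \<sigma>) (trans_ty A \<tau>)
      (sem M ?G (Lam (trans_ty A \<sigma>) (trans_tm A t)) \<delta>) y)" if xy: "related \<sigma> x y" for x y
    using Lam.IH[OF _ _ related_env_Cons[OF Lam.prems(3) xy]] Lam.prems(1,2)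
    unfolding Ap_sem_Lam[OF 1 related_in_El(1)[OF xy]] Ap_sem_Lam[OF 2 related_in_El(2)[OF xy]]
    by (simp add: standard_in_simps)
  then show ?case
    using typed_sem_in_El[OF 1] typed_sem_in_El[OF 2] by (simp del: sem.simps(5))
next
  case (App \<Gamma> t \<sigma> \<tau> p)
  have "related (\<sigma> \<rightarrowtail> \<tau>) (sem M \<Gamma> t \<gamma>) (sem M (map (trans_ty A) \<Gamma>) (trans_tm A t) \<delta>)"
    and "related \<sigma> (sem M \<Gamma> p \<gamma>) (sem M (map (trans_ty A) \<Gamma>) (trans_tm A p) \<delta>)"
    using App.IH App.prems by (simp_all add: standard_in_simps)
  then show ?case
    unfolding trans_tm.simps sem_App[OF App.hyps]
      sem_App[OF App.hyps[THEN has_type_trans_tm, of A, unfolded trans_ty.simps(2)]]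
    by simp
qed

end

section \<open>The theorem, by observing at \<alpha>\<close>

theorem theorem37:
  fixes M :: "'v interp" and t :: tm and \<alpha> :: "nat \<Rightarrow> nat"
  assumes "has_type [] t Pty"
    and "\<forall>\<sigma> \<in> types_in [] t \<union> types_in [] (dialT \<cdot> dialogueTree Pty t). standard M \<sigma>"
  shows "Ap M (Iota \<rightarrowtail> Iota) Iota (sem M [] t []) (seq M \<alpha>)
       = Ap M (Iota \<rightarrowtail> Iota) Iota (sem M [] (dialT \<cdot> dialogueTree Pty t) []) (seq M \<alpha>)"
proof -
  \<comment> \<open>\<open>?P\<close> is \<open>Pty\<close> written out, so that facts about
    function types apply to it.\<close>
  let ?P = "(Iota \<rightarrowtail> Iota) \<rightarrowtail> Iota"
  let ?C = "ChD Pty Iota"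
  let ?a = "seq M \<alpha>"
  let ?obs = "\<lambda>w. Ap M (Iota \<rightarrowtail> Iota) Iota w ?a"
  let ?D = "dialogueTree Pty t"
  let ?d = "sem M [] ?D []"
  \<comment> \<open>The two arguments that \<open>dialT\<close> gives to its tree; \<open>?e\<close>
    and \<open>?b\<close> are their values once \<open>dialT\<close> has received
    \<open>?d\<close>.\<close>
  let ?E = "Lam Iota (Lam (Iota \<rightarrowtail> Iota) (Var 1))"
  let ?B = "Lam (Iota \<rightarrowtail> Pty) (Lam Iota (Lam (Iota \<rightarrowtail> Iota) (Var 2 \<cdot> (Var 0 \<cdot> Var 1) \<cdot> Var 0)))"
  let ?e = "sem M [?C] ?E [?d]" and ?b = "sem M [?C] ?B [?d]"
  have t: "has_type [] t ?P"
    using assms(1) by (simp add: Pty_def)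
  have st: "standard_in M [] t" and sd: "standard_in M [] (dialT \<cdot> ?D)"
    using assms(2) by (auto simp: standard_in_def)
  have D: "has_type [] ?D ?C"
    using assms(1) by (rule has_type_dialogueTree)
  have sD: "standard_in M [] dialT" "standard_in M [] (trans_tm Pty t)"
    "standard_in M [] (generic Pty)" "standard_in M [] ?D"
    using sd unfolding dialogueTree_def standard_in_simps(6) by blast+
  have d: "?d \<in> El M ?C"
    by (rule sem_in_El[OF D sD(4)]) simp
  have 1: "typed_sem M [] [] dialT (?C \<rightarrowtail> Pty)"
    using has_type_dialT sD(1) by (simp add: typed_sem_def)
  note 1 = 1[unfolded dialT_def]
  note 2 = typed_sem_Lam[OF 1 d]
  have s2: "standard_in M [?C] ?E" "standard_in M [?C] ?B" "in_env M [?C] [?d]"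
    using 2 unfolding typed_sem_def standard_in_simps(6) by blast+
  have "has_type [?C] ?E (Iota \<rightarrowtail> ?P)"
    and "has_type [?C] ?B ((Iota \<rightarrowtail> ?P) \<rightarrowtail> Iota \<rightarrowtail> ?P)"
    unfolding Pty_def by (rule has_type_intros | simp)+
  \<comment> \<open>The result type is written out so that the innermost lambda can be opened too;
    the domain in \<open>B\<close> stays folded, as in the annotation of \<open>?B\<close>.\<close>
  then have E: "typed_sem M [?C] [?d] ?E (Iota \<rightarrowtail> ?P)"
    and B: "typed_sem M [?C] [?d] ?B ((Iota \<rightarrowtail> Pty) \<rightarrowtail> Iota \<rightarrowtail> ?P)"
    using s2 by (simp_all add: typed_sem_def Pty_def)
  have ii: "standard M (Iota \<rightarrowtail> Iota)"
    using typed_sem_standard[OF E] by (blast dest: standard_subtypes)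
  note a = seq_in_El[OF ii, of \<alpha>]
  interpret observation M Pty ?obs ?a ?b
  proof
    show "standard M (Iota \<rightarrowtail> Iota)" "?a \<in> El M (Iota \<rightarrowtail> Iota)"
      by (fact ii a)+
    show "?b \<in> El M ((Iota \<rightarrowtail> Pty) \<rightarrowtail> Iota \<rightarrowtail> Pty)"
      using typed_sem_in_El[OF B] by (simp add: Pty_def)
    \<comment> \<open>Three beta steps: \<open>?b\<close> applied to \<open>f\<close>,
      \<open>x\<close> and \<alpha> gives f (\<alpha> x) \<alpha>.\<close>
    show "?obs (Ap M Iota Pty (Ap M (Iota \<rightarrowtail> Pty) (Iota \<rightarrowtail> Pty) ?b f) x)
        = ?obs (Ap M Iota Pty f (Ap M Iota Iota ?a x))"
      if f: "f \<in> El M (Iota \<rightarrowtail> Pty)" and x: "x \<in> El M Iota" for f x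
      unfolding Ap_sem_Lam[OF B f, folded Pty_def]
      using Ap_sem_Lam[OF typed_sem_Lam[OF B f] x]
        Ap_sem_Lam[OF typed_sem_Lam[OF typed_sem_Lam[OF B f] x] a]
      by (simp add: Pty_def)
  qed
  let ?v = "?obs (sem M [] t [])"
  have T: "related ?P (sem M [] t []) (sem M [] (trans_tm Pty t) [])"
    using related_trans_tm[OF t st _ related_env_Nil] sD(2) unfolding list.map by blast
  have G: "related (Iota \<rightarrowtail> Iota) ?a (sem M [] (generic Pty) [])"
    by (rule related_generic[OF sD(3)]) simp
  have D_eq: "?d = Ap M (?C \<rightarrowtail> ?C) ?C (sem M [] (trans_tm Pty t) []) (sem M [] (generic Pty) [])"
    unfolding dialogueTree_def
    using has_type_trans_tm[OF t, of Pty] has_type_generic by (intro sem_App) simp_all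
  \<comment> \<open>\<alpha> is related to the generic sequence, so the value of \<open>t\<close> at
    \<alpha> is related to the dialogue tree.\<close>
  have r: "related Iota ?v ?d"
    using related_Ap[OF T G] unfolding trans_ty.simps D_eq[symmetric] .
  have e: "?e \<in> El M (Iota \<rightarrowtail> Pty)"
    using typed_sem_in_El[OF E] by (simp add: Pty_def)
  note v = related_in_El(1)[OF r]
  have "sem M [] (dialT \<cdot> ?D) [] = Ap M ?C Pty (sem M [] dialT []) ?d"
    by (rule sem_App[OF has_type_dialT D])
  also have "\<dots> = run M Pty ?d ?e ?b"
    unfolding dialT_def Ap_sem_Lam[OF 1 d] run_def by (simp add: ChD_def Pty_def del: sem.simps(5))
  finally have "?obs (sem M [] (dialT \<cdot> ?D) []) = ?obs (run M Pty ?d ?e ?b)"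
    by (rule arg_cong)
  \<comment> \<open>The base clause at the leaf interpretation \<open>?e\<close>, which is
    \<lambda>z w. z and therefore returns \<open>?v\<close> when observed at \<alpha>.\<close>
  also have "\<dots> = ?obs (Ap M Iota Pty ?e ?v)"
    using r e unfolding related.simps(1) by blast
  also have "\<dots> = ?v"
    using Ap_sem_Lam[OF E v] Ap_sem_Lam[OF typed_sem_Lam[OF E v] a] by (simp add: Pty_def)
  finally show ?thesis by (rule sym)
qed

end
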